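(* Let $n>1$, let $\Omega\subset\mathbb{R}^n$ be an open, bounded and connected domain, let $\boldsymbol{x}'\in\Omega$, and for $\Delta x>0$ consider a hypercube-shaped cell with centre $\boldsymbol{x}'$ and side length $\Delta x$ contained in $\Omega$. For $\varepsilon>0$ let $\boldsymbol{f}_\varepsilon$ and $\boldsymbol{f}_S$ be the smoothed force and the smoothed particle force defined in the context. Let $\boldsymbol{u}^\varepsilon_h\in\boldsymbol{V}_h(\Omega)$ be the Galerkin solution to $$a(\boldsymbol{u}^\varepsilon_h,\boldsymbol{\phi}_h)=\int_\Omega\boldsymbol{f}_\varepsilon\cdot\boldsymbol{\phi}_h\,d\Omega\quad\text{for all }\boldsymbol{\phi}_h\in\boldsymbol{V}_h(\Omega),$$ and let $\boldsymbol{u}^S_h\in\boldsymbol{V}_h(\Omega)$ be the Galerkin solution to $$a(\boldsymbol{u}^S_h,\boldsymbol{\phi}_h)=\int_\Omega\boldsymbol{f}_S\cdot\boldsymbol{\phi}_h\,d\Omega\quad\text{for all }\boldsymbol{\phi}_h\in\boldsymbol{V}_h(\Omega).$$ Then there is an $L_2>0$, independent of $\Delta x$ and $\varepsilon$, such that $$\frac{1}{(\Delta x)^n}\,\|\boldsymbol{u}^S_h-\boldsymbol{u}^\varepsilon_h\|_{\boldsymbol{H}^1(\Omega)}\leqslant L_2\,\frac{(\Delta x)^2}{\varepsilon^3}.$$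
   Context: Bold function spaces denote spaces of $\mathbb{R}^n$-valued functions. For a displacement field $\boldsymbol{u}$, $\boldsymbol{\epsilon}(\boldsymbol{u})=\frac12[\nabla\boldsymbol{u}+(\nabla\boldsymbol{u})^T]$, $$\boldsymbol{\sigma}(\boldsymbol{u})=\frac{E}{1+\nu}\Big\{\boldsymbol{\epsilon}(\boldsymbol{u})+\mathrm{tr}(\boldsymbol{\epsilon}(\boldsymbol{u}))\,\frac{\nu}{1-2\nu}\,\boldsymbol{I}\Big\},$$ with constant $E>0$, $0\le\nu<1/2$, and $a(\boldsymbol{u},\boldsymbol{v})=\int_\Omega\boldsymbol{\sigma}(\boldsymbol{u}):\boldsymbol{\epsilon}(\boldsymbol{v})\,d\Omega$. $\boldsymbol{V}_h(\Omega)\subset\boldsymbol{H}^1_0(\Omega)$ is a fixed finite-dimensional space spanned by continuous, piecewise linear Lagrangian basis field functions on a fixed finite mesh, vanishing on $\partial\Omega$. Let $P$ be a constant (force magnitude), $\boldsymbol{e}_i$ the $i$-th standard basis vector, and $$\delta_\varepsilon(\boldsymbol{x})=\frac{1}{(2\pi\varepsilon^2)^{n/2}}\exp\Big\{-\frac{\|\boldsymbol{x}\|^2}{2\varepsilon^2}\Big\}.$$ The smoothed forces on the hypercube cell (at the face midpoints, directed along the inward normals) are $$\boldsymbol{f}_\varepsilon(\boldsymbol{x})=P(\Delta x)^{n-1}\sum_{i=1}^n\boldsymbol{e}_i\Big[\delta_\varepsilon\big(\boldsymbol{x}-\boldsymbol{x}'+\tfrac{\Delta x}{2}\boldsymbol{e}_i\big)-\delta_\varepsilon\big(\boldsymbol{x}-\boldsymbol{x}'-\tfrac{\Delta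 x}{2}\boldsymbol{e}_i\big)\Big],$$ and the smoothed particle force is $$\boldsymbol{f}_S(\boldsymbol{x})=P(\Delta x)^n\,\nabla\delta_\varepsilon(\boldsymbol{x}-\boldsymbol{x}'),$$ where $\nabla$ is the gradient with respect to $\boldsymbol{x}$. *)

theory Defs
  imports "HOL-Analysis.Analysis"
begin

section \<open>Weak gradients and the H1 norm of vector fields\<close>

definition partial :: "(real^'n \<Rightarrow> real) \<Rightarrow> 'n \<Rightarrow> real^'n \<Rightarrow> real" where
  "partial f j x = frechet_derivative f (at x) (axis j 1)"

definition grad :: "(real^'n \<Rightarrow> real) \<Rightarrow> real^'n \<Rightarrow> real^'n" where
  "grad f x = (\<chi> j. partial f j x)"

text \<open>Test functions are once continuously differentiable with compact support in the open set.
  By mollification this yields the same weak derivatives as infinitely differentiable ones.\<close>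

definition test_function :: "(real^'n) set \<Rightarrow> (real^'n \<Rightarrow> real) \<Rightarrow> bool" where
  "test_function \<Omega> \<phi> \<longleftrightarrow>
     (\<forall>x. \<phi> differentiable (at x)) \<and> (\<forall>j. continuous_on UNIV (partial \<phi> j)) \<and>
     compact (closure {x. \<phi> x \<noteq> 0}) \<and> closure {x. \<phi> x \<noteq> 0} \<subseteq> \<Omega>"

definition L2_field :: "(real^'n) set \<Rightarrow> (real^'n \<Rightarrow> 'b::euclidean_space) \<Rightarrow> bool" where
  "L2_field \<Omega> u \<longleftrightarrow>
     u \<in> borel_measurable (lebesgue_on \<Omega>) \<and> integrable (lebesgue_on \<Omega>) (\<lambda>x. (norm (u x))\<^sup>2)"

text \<open>The entry \<open>G x $ i $ j\<close> is the weak derivative of the i-th component of \<open>u\<close>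
  in the j-th direction.\<close>

definition has_weak_gradient ::
    "(real^'n) set \<Rightarrow> (real^'n \<Rightarrow> real^'n) \<Rightarrow> (real^'n \<Rightarrow> real^'n^'n) \<Rightarrow> bool" where
  "has_weak_gradient \<Omega> u G \<longleftrightarrow> L2_field \<Omega> u \<and> L2_field \<Omega> G \<and>
     (\<forall>\<phi> i j. test_function \<Omega> \<phi> \<longrightarrow>
        (LINT x|lebesgue_on \<Omega>. u x $ i * partial \<phi> j x) =
        - (LINT x|lebesgue_on \<Omega>. G x $ i $ j * \<phi> x))"

text \<open>A weak gradient is unique up to null sets, so the choice below affects no integral.\<close>

definition weak_grad :: "(real^'n) set \<Rightarrow> (real^'n \<Rightarrow> real^'n) \<Rightarrow> real^'n \<Rightarrow> real^'n^'n" where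
  "weak_grad \<Omega> u = (SOME G. has_weak_gradient \<Omega> u G)"

text \<open>The norm of \<open>real^'n^'n\<close> is the Frobenius norm; likewise the inner product
  \<open>\<bullet>\<close> of matrices, used in the bilinear form below, is the double contraction.\<close>

definition H1_norm :: "(real^'n) set \<Rightarrow> (real^'n \<Rightarrow> real^'n) \<Rightarrow> real" where
  "H1_norm \<Omega> u = sqrt ((LINT x|lebesgue_on \<Omega>. (norm (u x))\<^sup>2) +
                       (LINT x|lebesgue_on \<Omega>. (norm (weak_grad \<Omega> u x))\<^sup>2))"


section \<open>Linear elasticity\<close>

definition strain :: "(real^'n) set \<Rightarrow> (real^'n \<Rightarrow> real^'n) \<Rightarrow> real^'n \<Rightarrow> real^'n^'n" where
  "strain \<Omega> u x = (1/2) *\<^sub>R (weak_grad \<Omega> u x + transpose (weak_grad \<Omega> u x))"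

definition stress ::
    "real \<Rightarrow> real \<Rightarrow> (real^'n) set \<Rightarrow> (real^'n \<Rightarrow> real^'n) \<Rightarrow> real^'n \<Rightarrow> real^'n^'n" where
  "stress E \<nu> \<Omega> u x = (E / (1 + \<nu>)) *\<^sub>R
     (strain \<Omega> u x + (trace (strain \<Omega> u x) * (\<nu> / (1 - 2 * \<nu>))) *\<^sub>R mat 1)"

definition elastic_form ::
    "real \<Rightarrow> real \<Rightarrow> (real^'n) set \<Rightarrow> (real^'n \<Rightarrow> real^'n) \<Rightarrow> (real^'n \<Rightarrow> real^'n) \<Rightarrow> real" where
  "elastic_form E \<nu> \<Omega> u v = (LINT x|lebesgue_on \<Omega>. stress E \<nu> \<Omega> u x \<bullet> strain \<Omega> v x)"


section \<open>Piecewise linear Lagrangian finite elements\<close>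

text \<open>A finite conforming mesh of full-dimensional simplices. It may fill \<open>closure \<Omega>\<close>,
  but since \<open>\<Omega>\<close> need not be polyhedral it is only required to lie in \<open>closure \<Omega>\<close>;
  finite element functions are extended by zero to the rest of the space.\<close>

definition fe_mesh :: "(real^'n) set \<Rightarrow> (real^'n) set set \<Rightarrow> bool" where
  "fe_mesh \<Omega> \<T> \<longleftrightarrow>
     triangulation \<T> \<and> (\<forall>K\<in>\<T>. int CARD('n) simplex K) \<and> \<Union>\<T> \<subseteq> closure \<Omega>"

definition mesh_nodes :: "(real^'n) set set \<Rightarrow> (real^'n) set" where
  "mesh_nodes \<T> = {p. \<exists>K\<in>\<T>. p extreme_point_of K}"

definition lagrange_function :: "(real^'n) set set \<Rightarrow> real^'n \<Rightarrow> (real^'n \<Rightarrow> real) \<Rightarrow> bool" where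
  "lagrange_function \<T> p \<psi> \<longleftrightarrow>
     (\<forall>K\<in>\<T>. \<exists>a b. \<forall>x\<in>K. \<psi> x = a \<bullet> x + b) \<and>
     (\<forall>q\<in>mesh_nodes \<T>. \<psi> q = (if q = p then 1 else 0)) \<and>
     (\<forall>x. x \<notin> \<Union>\<T> \<longrightarrow> \<psi> x = 0)"

text \<open>If the mesh does not fill \<open>closure \<Omega>\<close>, the extension by zero of a nodal function at the
  boundary of the mesh may jump inside \<open>\<Omega>\<close>; the continuity condition excludes it.
  The fields selected here are Lipschitz continuous and vanish outside \<open>\<Omega>\<close>, so they belong
  to the Sobolev space of H1 fields with zero trace.\<close>

definition lagrange_fields ::
    "(real^'n) set \<Rightarrow> (real^'n) set set \<Rightarrow> (real^'n \<Rightarrow> real^'n) set" where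
  "lagrange_fields \<Omega> \<T> = {(\<lambda>x. \<psi> x *\<^sub>R axis j 1) | \<psi> p j.
     p \<in> mesh_nodes \<T> \<and> lagrange_function \<T> p \<psi> \<and>
     continuous_on (closure \<Omega>) \<psi> \<and> (\<forall>x\<in>frontier \<Omega>. \<psi> x = 0)}"

text \<open>The linear span, written out because functions are not an instance of
  \<open>real_vector\<close>.\<close>

definition fe_space :: "(real^'n) set \<Rightarrow> (real^'n) set set \<Rightarrow> (real^'n \<Rightarrow> real^'n) set" where
  "fe_space \<Omega> \<T> =
     {(\<lambda>x. \<Sum>\<phi>\<in>B. c \<phi> *\<^sub>R \<phi> x) | B c. finite B \<and> B \<subseteq> lagrange_fields \<Omega> \<T>}"

definition galerkin_solution ::
    "real \<Rightarrow> real \<Rightarrow> (real^'n) set \<Rightarrow> (real^'n \<Rightarrow> real^'n) set \<Rightarrow>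
     (real^'n \<Rightarrow> real^'n) \<Rightarrow> (real^'n \<Rightarrow> real^'n) \<Rightarrow> bool" where
  "galerkin_solution E \<nu> \<Omega> V f u \<longleftrightarrow> u \<in> V \<and>
     (\<forall>\<phi>\<in>V. elastic_form E \<nu> \<Omega> u \<phi> = (LINT x|lebesgue_on \<Omega>. f x \<bullet> \<phi> x))"


section \<open>Smoothed forces\<close>

definition gauss_delta :: "real \<Rightarrow> real^'n \<Rightarrow> real" where
  "gauss_delta \<epsilon> x =
     1 / (2 * pi * \<epsilon>\<^sup>2) powr (real CARD('n) / 2) * exp (- ((norm x)\<^sup>2 / (2 * \<epsilon>\<^sup>2)))"

definition smoothed_force ::
    "real \<Rightarrow> real^'n \<Rightarrow> real \<Rightarrow> real \<Rightarrow> real^'n \<Rightarrow> real^'n" where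
  "smoothed_force P x' \<Delta> \<epsilon> x = (P * \<Delta> ^ (CARD('n) - 1)) *\<^sub>R
     (\<Sum>i\<in>UNIV. (gauss_delta \<epsilon> (x - x' + (\<Delta>/2) *\<^sub>R axis i 1) -
                  gauss_delta \<epsilon> (x - x' - (\<Delta>/2) *\<^sub>R axis i 1)) *\<^sub>R axis i 1)"

definition particle_force ::
    "real \<Rightarrow> real^'n \<Rightarrow> real \<Rightarrow> real \<Rightarrow> real^'n \<Rightarrow> real^'n" where
  "particle_force P x' \<Delta> \<epsilon> x =
     (P * \<Delta> ^ CARD('n)) *\<^sub>R grad (\<lambda>y. gauss_delta \<epsilon> (y - x')) x"

definition cell :: "real^'n \<Rightarrow> real \<Rightarrow> (real^'n) set" where
  "cell x' \<Delta> = cbox (x' - (\<chi> i. \<Delta>/2)) (x' + (\<chi> i. \<Delta>/2))"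

end

theory Submission
  imports Defs "HOL-Probability.Distributions"
begin

text \<open>The difference \<open>w\<close> of the two Galerkin solutions lies in the finite element space and solves
  the Galerkin problem with the difference of the two forces as right-hand side. The proof combines a
  consistency estimate for this right-hand side with a stability estimate on the space.

  \<^emph>\<open>Consistency.\<close> Up to the factor \<open>P * \<Delta> ^ CARD('n)\<close>, the \<open>i\<close>-th component of the difference of the
  forces is the error of the central difference quotient, with step \<open>\<Delta> / 2\<close>, of the Gaussian in
  direction \<open>i\<close>. It is bounded pointwise by a constant times \<open>\<Delta>\<^sup>2 / \<epsilon> ^ 3\<close> times a sum of three
  Gaussians of width \<open>2 * \<epsilon>\<close> (\<open>gauss_delta_central_difference\<close>): for small \<open>\<Delta>\<close> by Taylor's formula,
  for large \<open>\<Delta>\<close> because each term is separately of this size. Gaussians have integral one, so the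
  integral of the difference of the forces against a bounded field is at most of order
  \<open>\<Delta> ^ CARD('n) * (\<Delta>\<^sup>2 / \<epsilon> ^ 3)\<close> times the supremum norm of that field (\<open>smoothed_force_error\<close>).

  \<^emph>\<open>Stability.\<close> The finite element space has finite dimension and does not depend on \<open>\<Delta>\<close> and \<open>\<epsilon>\<close>. If
  the elastic form is an inner product on it, \<open>w\<close> can be expanded in a fixed orthonormal basis of this
  inner product. The coefficients are the values of the right-hand side at the basis fields, and
  these values have just been bounded (\<open>elastic_form_controls_H1_norm\<close>).

  It remains to see that the elastic form is bilinear and positive definite on piecewise affine
  fields. Its definition involves weak gradients, so it has to be known that the weak gradient of
  such a field is its piecewise constant classical gradient (\<open>pw_affine_has_weak_gradient\<close>), and that weak
  gradients are unique almost everywhere (\<open>has_weak_gradient_unique\<close>). Definiteness then amounts to the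
  statement that a piecewise affine field with vanishing strain vanishes, which is elementary and
  needs no Korn inequality (\<open>pw_affine_zero_strain_imp_zero\<close>).\<close>

section \<open>The Gaussian and its central differences\<close>

lemma gauss_delta_alt:
  fixes y :: "real^'n"
  assumes "\<epsilon> > 0"
  shows "gauss_delta \<epsilon> y = exp (- ((norm y)\<^sup>2 / (2 * \<epsilon>\<^sup>2))) / (sqrt (2 * pi) * \<epsilon>) ^ CARD('n)"
proof -
  have "(2 * pi * \<epsilon>\<^sup>2) powr (real CARD('n) / 2) = sqrt (2 * pi * \<epsilon>\<^sup>2) ^ CARD('n)"
  proof -
    have "(2 * pi * \<epsilon>\<^sup>2) powr (real CARD('n) / 2) =
        ((2 * pi * \<epsilon>\<^sup>2) powr (1 / 2)) powr real CARD('n)"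
      by (simp only: powr_powr) simp
    also have "(2 * pi * \<epsilon>\<^sup>2) powr (1 / 2) = sqrt (2 * pi * \<epsilon>\<^sup>2)"
      using assms by (intro powr_half_sqrt) simp
    also have "\<dots> powr real CARD('n) = sqrt (2 * pi * \<epsilon>\<^sup>2) ^ CARD('n)"
      using assms by (intro powr_realpow) simp
    finally show ?thesis .
  qed
  then show ?thesis
    using assms by (simp add: gauss_delta_def real_sqrt_mult)
qed

lemma gauss_delta_nonneg [simp]: "gauss_delta \<epsilon> y \<ge> 0"
  by (simp add: gauss_delta_def)

lemma continuous_on_gauss_delta [continuous_intros]:
  fixes f :: "'a::topological_space \<Rightarrow> real^'n"
  assumes "continuous_on S f"
  shows "continuous_on S (\<lambda>x. gauss_delta \<epsilon> (f x))"
proof (cases "\<epsilon> = 0")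
  case False
  then show ?thesis
    unfolding gauss_delta_def by (intro continuous_intros assms) auto
qed (simp add: gauss_delta_def)

lemma gauss_delta_has_bochner_integral:
  assumes "\<epsilon> > 0"
  shows "has_bochner_integral lborel (gauss_delta \<epsilon> :: real^'n \<Rightarrow> real) 1"
proof (rule has_bochner_integral_nn_integral)
  have *: "gauss_delta \<epsilon> x = (\<Prod>b\<in>Basis. normal_density 0 \<epsilon> (x \<bullet> b))" for x :: "real^'n"
  proof -
    have "(\<Prod>b\<in>Basis. normal_density 0 \<epsilon> (x \<bullet> b)) =
        (1 / sqrt (2 * pi * \<epsilon>\<^sup>2)) ^ CARD('n) * exp (\<Sum>b\<in>Basis. - ((x \<bullet> b)\<^sup>2 / (2 * \<epsilon>\<^sup>2)))"
      by (simp add: normal_density_def prod.distrib exp_sum prod_dividef power_one_over divide_simps del: real_sqrt_mult)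
    also have "(\<Sum>b\<in>Basis. - ((x \<bullet> b)\<^sup>2 / (2 * \<epsilon>\<^sup>2))) = - ((norm x)\<^sup>2 / (2 * \<epsilon>\<^sup>2))"
      by (simp add: norm_eq_sqrt_inner euclidean_inner[of x x] sum_negf sum_divide_distrib power2_eq_square sum_nonneg)
    finally show ?thesis
      using assms by (simp add: gauss_delta_alt real_sqrt_mult power_divide)
  qed
  have "(\<integral>\<^sup>+x. ennreal (normal_density 0 \<epsilon> x) \<partial>lborel) = 1"
    using assms by (subst nn_integral_eq_integral) auto
  then show "(\<integral>\<^sup>+x. ennreal (gauss_delta \<epsilon> (x::real^'n)) \<partial>lborel) = ennreal 1"
    unfolding * using assms
    by (subst prod_ennreal [symmetric])
      (auto simp: nn_integral_lborel_prod [where f = "\<lambda>_ x. ennreal (normal_density 0 \<epsilon> x)"])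
qed (auto intro!: borel_measurable_continuous_onI continuous_intros)

lemma gauss_delta_shift:
  fixes y :: "real^'n"
  assumes "\<epsilon> > 0"
  shows "gauss_delta \<epsilon> (y + t *\<^sub>R axis i 1) =
    exp (- ((norm y)\<^sup>2 - (y $ i)\<^sup>2) / (2 * \<epsilon>\<^sup>2)) / (sqrt (2 * pi) * \<epsilon>) ^ CARD('n) *
    exp (- ((y $ i + t)\<^sup>2 / (2 * \<epsilon>\<^sup>2)))"
proof -
  have "(norm (y + t *\<^sub>R axis i 1))\<^sup>2 = ((norm y)\<^sup>2 - (y $ i)\<^sup>2) + (y $ i + t)\<^sup>2"
    unfolding power2_norm_eq_inner
    by (simp add: inner_simps inner_axis inner_axis' inner_axis_axis power2_eq_square algebra_simps)
  then show ?thesis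
    by (simp add: gauss_delta_alt[OF assms] exp_add [symmetric] add_divide_distrib diff_divide_distrib)
qed

text \<open>The Gaussian of twice the width serves as the majorant in the pointwise estimates below:
  it decays like the fourth root of \<open>gauss_delta \<epsilon>\<close>, which leaves room to absorb polynomial
  factors and shifts by at most \<open>\<epsilon>\<close>.\<close>

lemma gauss_delta_double:
  fixes y :: "real^'n"
  assumes "\<epsilon> > 0"
  shows "exp (- ((norm y)\<^sup>2 / (8 * \<epsilon>\<^sup>2))) / (sqrt (2 * pi) * \<epsilon>) ^ CARD('n)
      = 2 ^ CARD('n) * gauss_delta (2 * \<epsilon>) y"
  using assms by (simp add: gauss_delta_alt power_mult_distrib)

lemma gauss_delta_directional_derivatives:
  fixes y :: "real^'n" and i :: 'n
  assumes "\<epsilon> > 0"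
  defines "g \<equiv> \<lambda>t. gauss_delta \<epsilon> (y + t *\<^sub>R axis i 1)"
    and "v \<equiv> \<lambda>t. (y $ i + t) / \<epsilon>"
  shows "(g has_real_derivative - (v t / \<epsilon>) * g t) (at t)"
    and "((\<lambda>t. - (v t / \<epsilon>) * g t) has_real_derivative (((v t)\<^sup>2 - 1) / \<epsilon>\<^sup>2) * g t) (at t)"
    and "((\<lambda>t. (((v t)\<^sup>2 - 1) / \<epsilon>\<^sup>2) * g t) has_real_derivative
            ((3 * v t - v t ^ 3) / \<epsilon> ^ 3) * g t) (at t)"
proof -
  have [simp]: "\<epsilon> \<noteq> 0" using assms(1) by simp
  define K where "K = exp (- ((norm y)\<^sup>2 - (y $ i)\<^sup>2) / (2 * \<epsilon>\<^sup>2)) / (sqrt (2 * pi) * \<epsilon>) ^ CARD('n)"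
  have g: "g = (\<lambda>t. K * exp (- ((v t)\<^sup>2 / 2)))"
    unfolding g_def v_def gauss_delta_shift[OF assms(1)] K_def by (simp add: power_divide mult.commute)
  have v: "(v has_real_derivative 1 / \<epsilon>) (at t)" for t
    unfolding v_def by (auto intro!: derivative_eq_intros)
  have e: "((\<lambda>t. exp (- ((v t)\<^sup>2 / 2))) has_real_derivative - (v t / \<epsilon>) * exp (- ((v t)\<^sup>2 / 2))) (at t)" for t
    by (rule derivative_eq_intros v refl | simp)+
  show 1: "(g has_real_derivative - (v t / \<epsilon>) * g t) (at t)" for t
    unfolding g using DERIV_cmult[OF e[of t], of K] by (simp add: mult.left_commute)
  show "((\<lambda>t. - (v t / \<epsilon>) * g t) has_real_derivative (((v t)\<^sup>2 - 1) / \<epsilon>\<^sup>2) * g t) (at t)"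
    by (rule DERIV_cong[OF DERIV_mult[OF DERIV_minus[OF DERIV_cdivide[OF v]] 1]])
      (simp add: field_simps power2_eq_square)
  have "((\<lambda>t. ((v t)\<^sup>2 - 1) / \<epsilon>\<^sup>2) has_real_derivative 2 * v t / \<epsilon> ^ 3) (at t)"
    by (rule derivative_eq_intros v refl | simp add: power2_eq_square power3_eq_cube)+
  from DERIV_mult[OF this 1]
  show "((\<lambda>t. (((v t)\<^sup>2 - 1) / \<epsilon>\<^sup>2) * g t) has_real_derivative
            ((3 * v t - v t ^ 3) / \<epsilon> ^ 3) * g t) (at t)"
    by (rule DERIV_cong) (simp add: field_simps power2_eq_square power3_eq_cube)
qed

lemma directional_derivative_eq_partial:
  fixes f :: "real^'n \<Rightarrow> real" and i :: 'n
  assumes "f differentiable (at (x + t *\<^sub>R axis i 1))"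
  shows "((\<lambda>t. f (x + t *\<^sub>R axis i 1)) has_real_derivative partial f i (x + t *\<^sub>R axis i 1)) (at t)"
proof -
  let ?D = "frechet_derivative f (at (x + t *\<^sub>R axis i 1))"
  have "(f has_derivative ?D) (at (x + t *\<^sub>R axis i 1))"
    using assms by (simp add: frechet_derivative_works)
  then have "((\<lambda>t. f (x + t *\<^sub>R axis i 1)) has_derivative (\<lambda>s. ?D (s *\<^sub>R axis i 1))) (at t)"
    by (auto intro!: derivative_eq_intros has_derivative_compose [of "\<lambda>t. x + t *\<^sub>R axis i 1" _ t UNIV f])
  moreover have "linear ?D"
    using assms by (rule linear_frechet_derivative)
  then have "(\<lambda>s. ?D (s *\<^sub>R axis i 1)) = (*) (partial f i (x + t *\<^sub>R axis i 1))"
    by (auto simp: fun_eq_iff partial_def linear_cmul)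
  ultimately show ?thesis
    by (simp add: has_field_derivative_def)
qed

lemma gauss_delta_differentiable:
  fixes c :: "real^'n"
  assumes "\<epsilon> > 0"
  shows "(\<lambda>x. gauss_delta \<epsilon> (x - c)) differentiable (at x)"
proof -
  have "(\<lambda>x. (norm (x - c))\<^sup>2) differentiable (at x)"
    unfolding power2_norm_eq_inner by (auto intro!: derivative_intros)
  then obtain D where D: "((\<lambda>x. (norm (x - c))\<^sup>2) has_derivative D) (at x)"
    unfolding differentiable_def by blast
  show ?thesis
    unfolding gauss_delta_def
    by (rule differentiableI, rule has_derivative_mult_right, rule has_derivative_exp,
        rule has_derivative_minus) (rule bounded_linear.has_derivative[OF bounded_linear_divide D])
qed

lemma partial_gauss_delta:
  fixes c :: "real^'n" and i :: 'n
  assumes "\<epsilon> > 0"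
  shows "partial (\<lambda>x. gauss_delta \<epsilon> (x - c)) i x =
    - ((x - c) $ i / \<epsilon> / \<epsilon>) * gauss_delta \<epsilon> (x - c)"
proof -
  have "((\<lambda>t. gauss_delta \<epsilon> (x - c + t *\<^sub>R axis i 1)) has_real_derivative
      partial (\<lambda>x. gauss_delta \<epsilon> (x - c)) i x) (at 0)"
    using directional_derivative_eq_partial[OF gauss_delta_differentiable[OF assms], where x = x and t = 0 and i = i]
    by (simp add: algebra_simps)
  from DERIV_unique[OF this gauss_delta_directional_derivatives(1)[OF assms]]
  show ?thesis by simp
qed

lemma abs_mult_exp_bounds:
  fixes s :: real
  shows "\<bar>s\<bar> \<le> exp (s\<^sup>2 / 4)" and "\<bar>3 * s - s ^ 3\<bar> \<le> 15 * exp (s\<^sup>2 / 4)"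
proof -
  define q where "q = s\<^sup>2 / 4"
  have q: "q \<ge> 0" "s\<^sup>2 = 4 * q" by (auto simp: q_def)
  \<comment> \<open>Both bounds follow from \<open>1 + q + q\<^sup>2 / 2 \<le> exp q\<close>.\<close>
  have e1: "1 + q \<le> exp q" by (rule exp_ge_add_one_self)
  have e2: "1 + q + q\<^sup>2 / 2 \<le> exp q" by (rule exp_lower_Taylor_quadratic[OF q(1)])
  have a: "\<bar>s\<bar> \<le> 1 + q"
  proof -
    have "0 \<le> (\<bar>s\<bar> / 2 - 1)\<^sup>2" by simp
    then show ?thesis by (simp add: q_def power2_eq_square algebra_simps)
  qed
  then show "\<bar>s\<bar> \<le> exp (s\<^sup>2 / 4)" using e1 by (metis order_trans q_def)
  have "\<bar>s ^ 3\<bar> = s\<^sup>2 * \<bar>s\<bar>" by (simp add: power3_eq_cube power2_eq_square abs_mult)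
  also have "\<dots> \<le> (4 * q) * (1 + q)" unfolding q(2) using a q(1) by (intro mult_left_mono) auto
  also have "\<dots> = 4 * q + 4 * q\<^sup>2" by (simp add: power2_eq_square algebra_simps)
  finally have "\<bar>s ^ 3\<bar> \<le> 4 * q + 4 * q\<^sup>2" .
  moreover have "\<bar>3 * s - s ^ 3\<bar> \<le> 3 * \<bar>s\<bar> + \<bar>s ^ 3\<bar>" by (simp add: abs_if)
  ultimately have "\<bar>3 * s - s ^ 3\<bar> \<le> 3 + 7 * q + 4 * q\<^sup>2" using a by linarith
  also have "\<dots> \<le> 15 * (1 + q + q\<^sup>2 / 2)"
  proof -
    have "3 + 7 * q + 4 * p \<le> 15 * (1 + q + p / 2)" if "p \<ge> 0" for p :: real
      using that q(1) by (simp add: field_simps)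
    then show ?thesis by simp
  qed
  also have "\<dots> \<le> 15 * exp q" using e2 by simp
  finally show "\<bar>3 * s - s ^ 3\<bar> \<le> 15 * exp (s\<^sup>2 / 4)" by (simp add: q_def)
qed

text \<open>The second order Taylor terms at \<open>h\<close> and \<open>- h\<close> cancel in the difference, so that the error of
  the quotient is of second order in \<open>h\<close>.\<close>

lemma central_difference_bound:
  fixes g :: "real \<Rightarrow> real"
  assumes "h > 0"
    and "\<And>t. (g has_real_derivative g1 t) (at t)"
    and "\<And>t. (g1 has_real_derivative g2 t) (at t)"
    and "\<And>t. (g2 has_real_derivative g3 t) (at t)"
    and "\<And>t. \<bar>t\<bar> \<le> h \<Longrightarrow> \<bar>g3 t\<bar> \<le> M"
  shows "\<bar>g1 0 - (g h - g (- h)) / (2 * h)\<bar> \<le> h\<^sup>2 / 6 * M"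
proof -
  define D where "D m = [g, g1, g2, g3] ! m" for m :: nat
  have D: "D 0 = g" "D 1 = g1" "D (Suc 0) = g1" "D 2 = g2" "D 3 = g3" by (auto simp: D_def eval_nat_numeral)
  have DD: "\<forall>m t. m < 3 \<and> \<bar>t\<bar> \<le> \<bar>x\<bar> \<longrightarrow> (D m has_real_derivative D (Suc m) t) (at t)" for x
    using assms(2-4) by (auto simp: D_def eval_nat_numeral less_Suc_eq)
  obtain s where s: "\<bar>s\<bar> \<le> \<bar>h\<bar>" "g h = (\<Sum>m<3. D m 0 / fact m * h ^ m) + D 3 s / fact 3 * h ^ 3"
    using Maclaurin_bi_le[OF D(1) DD[of h]] by auto
  obtain r where r: "\<bar>r\<bar> \<le> \<bar>- h\<bar>" "g (-h) = (\<Sum>m<3. D m 0 / fact m * (-h) ^ m) + D 3 r / fact 3 * (-h) ^ 3"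
    using Maclaurin_bi_le[OF D(1) DD[of "-h"]] by auto
  have "g h - g (-h) = 2 * h * g1 0 + h ^ 3 / 6 * (g3 s + g3 r)"
    unfolding s(2) r(2) by (simp add: D eval_nat_numeral fact_numeral algebra_simps) (simp add: D_def)
  then have "g1 0 - (g h - g (- h)) / (2 * h) = - (h\<^sup>2 / 12 * (g3 s + g3 r))"
    using assms(1) by (simp add: field_simps power2_eq_square power3_eq_cube)
  moreover have "\<bar>g3 s + g3 r\<bar> \<le> 2 * M"
    using assms(5)[of s] assms(5)[of r] s(1) r(1) assms(1) by linarith
  ultimately show ?thesis
    using mult_left_mono[of "\<bar>g3 s + g3 r\<bar>" "2 * M" "h\<^sup>2 / 12"] by (simp add: abs_mult mult.commute mult.left_commute)
qed

lemma gauss_delta_le_double: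
  fixes y :: "real^'n"
  assumes "\<epsilon> > 0"
  shows "gauss_delta \<epsilon> y \<le> 2 ^ CARD('n) * gauss_delta (2 * \<epsilon>) y"
    and "\<bar>y $ i\<bar> / \<epsilon> * gauss_delta \<epsilon> y \<le> 2 ^ CARD('n) * gauss_delta (2 * \<epsilon>) y"
proof -
  define N where "N = (sqrt (2 * pi) * \<epsilon>) ^ CARD('n)"
  have N: "N > 0" using assms by (simp add: N_def)
  define q where "q = (norm y)\<^sup>2 / (8 * \<epsilon>\<^sup>2)"
  have q: "q \<ge> 0" by (simp add: q_def)
  have g: "gauss_delta \<epsilon> y = exp (- 4 * q) / N"
    using assms by (simp add: gauss_delta_alt q_def N_def)
  have d: "2 ^ CARD('n) * gauss_delta (2 * \<epsilon>) y = exp (- q) / N"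
    using gauss_delta_double[OF assms, of y] by (simp add: q_def N_def)
  show "gauss_delta \<epsilon> y \<le> 2 ^ CARD('n) * gauss_delta (2 * \<epsilon>) y"
    unfolding g d using q N by (intro divide_right_mono) auto
  have "(y $ i)\<^sup>2 \<le> (norm y)\<^sup>2"
    using component_le_norm_cart[of y i] by (simp add: abs_le_square_iff [symmetric])
  then have v: "(y $ i / \<epsilon>)\<^sup>2 / 4 \<le> 2 * q"
    using assms by (simp add: q_def power_divide field_simps)
  have "\<bar>y $ i\<bar> / \<epsilon> = \<bar>y $ i / \<epsilon>\<bar>" using assms by simp
  also have "\<dots> \<le> exp ((y $ i / \<epsilon>)\<^sup>2 / 4)" by (rule abs_mult_exp_bounds)
  also have "\<dots> \<le> exp (2 * q)" using v by simp
  finally have "\<bar>y $ i\<bar> / \<epsilon> * (exp (- 4 * q) / N) \<le> exp (2 * q) * (exp (- 4 * q) / N)"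
    using N by (intro mult_right_mono) auto
  also have "\<dots> = exp (- 2 * q) / N" by (simp add: exp_add [symmetric])
  also have "\<dots> \<le> exp (- q) / N" using q N by (intro divide_right_mono) auto
  finally show "\<bar>y $ i\<bar> / \<epsilon> * gauss_delta \<epsilon> y \<le> 2 ^ CARD('n) * gauss_delta (2 * \<epsilon>) y"
    unfolding g d .
qed

lemma gauss_delta_third_derivative_bound:
  fixes y :: "real^'n" and i :: 'n
  assumes "\<epsilon> > 0" and "\<bar>t\<bar> \<le> \<epsilon>"
  defines "v \<equiv> (y $ i + t) / \<epsilon>"
  shows "\<bar>(3 * v - v ^ 3) / \<epsilon> ^ 3 * gauss_delta \<epsilon> (y + t *\<^sub>R axis i 1)\<bar>
      \<le> 24 * 2 ^ CARD('n) / \<epsilon> ^ 3 * gauss_delta (2 * \<epsilon>) y"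
proof -
  define N where "N = (sqrt (2 * pi) * \<epsilon>) ^ CARD('n)"
  have N: "N > 0" using assms by (simp add: N_def)
  define z where "z = y + t *\<^sub>R axis i 1"
  define q where "q = (norm z)\<^sup>2 / (4 * \<epsilon>\<^sup>2)"
  define r where "r = (norm y)\<^sup>2 / (8 * \<epsilon>\<^sup>2)"
  have g: "gauss_delta \<epsilon> z = exp (- 2 * q) / N"
    using assms by (simp add: gauss_delta_alt q_def N_def)
  have d: "2 ^ CARD('n) * gauss_delta (2 * \<epsilon>) y = exp (- r) / N"
    using gauss_delta_double[OF assms(1), of y] by (simp add: r_def N_def)
  have "v = z $ i / \<epsilon>" by (simp add: v_def z_def axis_def)
  moreover have "(z $ i)\<^sup>2 \<le> (norm z)\<^sup>2"
    using component_le_norm_cart[of z i] by (simp add: abs_le_square_iff [symmetric])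
  ultimately have "v\<^sup>2 \<le> (norm z)\<^sup>2 / \<epsilon>\<^sup>2"
    by (simp add: power_divide divide_right_mono)
  then have v: "v\<^sup>2 / 4 \<le> q"
    by (simp add: q_def)
  have "norm y \<le> norm z + \<bar>t\<bar>"
    using norm_triangle_ineq4[of z "t *\<^sub>R axis i 1"] by (simp add: z_def)
  then have "(norm y)\<^sup>2 \<le> (norm z + \<bar>t\<bar>)\<^sup>2"
    by (intro power_mono) auto
  also have "\<dots> \<le> 2 * (norm z)\<^sup>2 + 2 * \<bar>t\<bar>\<^sup>2"
    using zero_le_power2[of "norm z - \<bar>t\<bar>"] by (simp add: power2_eq_square algebra_simps)
  also have "\<bar>t\<bar>\<^sup>2 \<le> \<epsilon>\<^sup>2" using assms(1,2) by (intro power_mono) auto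
  finally have "r \<le> q + 1 / 4"
    using assms(1) by (simp add: q_def r_def field_simps)
  then have "exp (- q) \<le> exp (1 / 4 - r)" by simp
  also have "\<dots> = exp (1 / 4) * exp (- r)" by (simp add: exp_add [symmetric])
  also have "exp (1 / 4 :: real) \<le> 8 / 5"
    using exp_bound[of "1 / 4 :: real"] by (simp add: power2_eq_square)
  finally have er: "exp (- q) \<le> 8 / 5 * exp (- r)" by simp
  have "\<bar>3 * v - v ^ 3\<bar> \<le> 15 * exp (v\<^sup>2 / 4)" by (rule abs_mult_exp_bounds)
  also have "\<dots> \<le> 15 * exp q" using v by simp
  finally have "\<bar>3 * v - v ^ 3\<bar> * exp (- 2 * q) \<le> 15 * exp q * exp (- 2 * q)"
    by (intro mult_right_mono) auto
  also have "\<dots> = 15 * exp (- q)" by (simp add: exp_add [symmetric])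
  also have "\<dots> \<le> 24 * exp (- r)" using er by simp
  finally have "\<bar>3 * v - v ^ 3\<bar> * exp (- 2 * q) / (\<epsilon> ^ 3 * N) \<le> 24 * exp (- r) / (\<epsilon> ^ 3 * N)"
    using assms(1) N by (intro divide_right_mono) auto
  moreover have "\<bar>(3 * v - v ^ 3) / \<epsilon> ^ 3 * gauss_delta \<epsilon> z\<bar> = \<bar>3 * v - v ^ 3\<bar> * exp (- 2 * q) / (\<epsilon> ^ 3 * N)"
    unfolding g using assms(1) N by (simp add: abs_mult abs_divide)
  moreover have "24 * 2 ^ CARD('n) / \<epsilon> ^ 3 * gauss_delta (2 * \<epsilon>) y = 24 / \<epsilon> ^ 3 * (exp (- r) / N)"
    unfolding d [symmetric] by simp
  ultimately show ?thesis
    unfolding z_def by simp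
qed

text \<open>The bound holds for every step \<open>h\<close>, although Taylor's formula with a pointwise remainder is only
  useful for \<open>h \<le> \<epsilon>\<close>. For \<open>h > \<epsilon>\<close> each of the three terms on the left is at most of order
  \<open>1 / \<epsilon> \<le> h\<^sup>2 / \<epsilon> ^ 3\<close> times a Gaussian; this is where the two shifted Gaussians enter.
  All Gaussians on the right have total mass one, so integration loses no power of \<open>\<epsilon>\<close>.\<close>

lemma gauss_delta_central_difference:
  fixes y :: "real^'n"
  assumes "\<epsilon> > 0" and "h > 0"
  shows "\<bar>- (y $ i / \<epsilon> / \<epsilon>) * gauss_delta \<epsilon> y
        - (gauss_delta \<epsilon> (y + h *\<^sub>R axis i 1) - gauss_delta \<epsilon> (y - h *\<^sub>R axis i 1)) / (2 * h)\<bar>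
      \<le> 4 * 2 ^ CARD('n) * h\<^sup>2 / \<epsilon> ^ 3 * (gauss_delta (2 * \<epsilon>) y
          + gauss_delta (2 * \<epsilon>) (y + h *\<^sub>R axis i 1) + gauss_delta (2 * \<epsilon>) (y - h *\<^sub>R axis i 1))"
    (is "\<bar>?d - (?p - ?m) / _\<bar> \<le> ?c * (?k + ?kp + ?km)")
proof (cases "h \<le> \<epsilon>")
  case True
  note D = gauss_delta_directional_derivatives[OF assms(1), of y i]
  have "\<bar>- ((y $ i + 0) / \<epsilon> / \<epsilon>) * gauss_delta \<epsilon> (y + 0 *\<^sub>R axis i 1) -
      (gauss_delta \<epsilon> (y + h *\<^sub>R axis i 1) - gauss_delta \<epsilon> (y + (- h) *\<^sub>R axis i 1)) / (2 * h)\<bar>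
    \<le> h\<^sup>2 / 6 * (24 * 2 ^ CARD('n) / \<epsilon> ^ 3 * ?k)"
    by (rule central_difference_bound[OF assms(2) D])
      (use True assms in \<open>intro gauss_delta_third_derivative_bound, auto\<close>)
  also have "\<dots> = ?c * ?k" by simp
  also have "\<dots> \<le> ?c * (?k + ?kp + ?km)"
    using assms by (intro mult_left_mono) auto
  finally show ?thesis by simp
next
  case False
  let ?C = "2 ^ CARD('n) :: real"
  have 1: "1 / \<epsilon> \<le> h\<^sup>2 / \<epsilon> ^ 3"
  proof -
    have "\<epsilon>\<^sup>2 \<le> h\<^sup>2" using False assms by (intro power_mono) auto
    then show ?thesis using assms by (simp add: field_simps power2_eq_square power3_eq_cube)
  qed
  have 2: "1 / (2 * h) \<le> 1 / \<epsilon>" using False assms by (simp add: field_simps)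
  have "\<bar>?d\<bar> = 1 / \<epsilon> * (\<bar>y $ i\<bar> / \<epsilon> * gauss_delta \<epsilon> y)"
    using assms by (simp add: abs_mult)
  also have "\<dots> \<le> 1 / \<epsilon> * (?C * ?k)"
    using assms gauss_delta_le_double(2)[OF assms(1)] by (intro mult_left_mono) auto
  finally have a: "\<bar>?d\<bar> \<le> 1 / \<epsilon> * (?C * ?k)" .
  have "\<bar>(?p - ?m) / (2 * h)\<bar> = 1 / (2 * h) * \<bar>?p - ?m\<bar>" using assms by simp
  also have "\<dots> \<le> 1 / \<epsilon> * (?C * ?kp + ?C * ?km)"
  proof (intro mult_mono 2)
    show "\<bar>?p - ?m\<bar> \<le> ?C * ?kp + ?C * ?km"
      using gauss_delta_le_double(1)[OF assms(1), of "y + h *\<^sub>R axis i 1"]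
        gauss_delta_le_double(1)[OF assms(1), of "y - h *\<^sub>R axis i 1"]
        gauss_delta_nonneg[of \<epsilon> "y + h *\<^sub>R axis i 1"] gauss_delta_nonneg[of \<epsilon> "y - h *\<^sub>R axis i 1"]
      by linarith
  qed (use assms in auto)
  finally have "\<bar>?d - (?p - ?m) / (2 * h)\<bar> \<le> 1 / \<epsilon> * (?C * ?k) + 1 / \<epsilon> * (?C * ?kp + ?C * ?km)"
    using a by linarith
  also have "\<dots> = 1 / \<epsilon> * (?C * (?k + ?kp + ?km))" by (simp add: algebra_simps)
  also have "\<dots> \<le> h\<^sup>2 / \<epsilon> ^ 3 * (4 * (?C * (?k + ?kp + ?km)))"
  proof (rule mult_mono[OF 1])
    have "0 \<le> ?C * (?k + ?kp + ?km)" by (intro mult_nonneg_nonneg add_nonneg_nonneg) auto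
    then show "?C * (?k + ?kp + ?km) \<le> 4 * (?C * (?k + ?kp + ?km))"
      by linarith
  qed (use assms in auto)
  finally show ?thesis by (simp add: mult_ac)
qed

lemma lebesgue_on_integral_le:
  fixes f :: "real^'n \<Rightarrow> real"
  assumes "\<Omega> \<in> sets lebesgue" and f: "has_bochner_integral lborel f I" and "\<And>x. 0 \<le> f x"
  shows "integrable (lebesgue_on \<Omega>) f" and "(LINT x|lebesgue_on \<Omega>. f x) \<le> I"
proof -
  have m: "f \<in> borel_measurable lborel" using f by (auto simp: has_bochner_integral_iff)
  have i: "integrable lebesgue f" "(LINT x|lebesgue. f x) = I"
    using f integrable_completion[OF m] integral_completion[OF m] by (auto simp: has_bochner_integral_iff)
  have ii: "integrable lebesgue (\<lambda>x. indicator \<Omega> x *\<^sub>R f x)"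
    using assms(1) i(1) by (rule integrable_mult_indicator)
  then show "integrable (lebesgue_on \<Omega>) f"
    using assms(1) by (simp add: integrable_restrict_space)
  have "(LINT x|lebesgue_on \<Omega>. f x) = (LINT x|lebesgue. indicator \<Omega> x *\<^sub>R f x)"
    using assms(1) by (simp add: integral_restrict_space)
  also have "\<dots> \<le> (LINT x|lebesgue. f x)"
    using i(1) assms(3) by (intro integral_mono ii) (auto simp: indicator_def)
  finally show "(LINT x|lebesgue_on \<Omega>. f x) \<le> I" using i(2) by simp
qed

lemma gauss_delta_translate_has_bochner_integral:
  fixes c :: "real^'n"
  assumes "\<epsilon> > 0"
  shows "has_bochner_integral lborel (\<lambda>x. gauss_delta \<epsilon> (x - c)) 1"
proof -
  have m: "(gauss_delta \<epsilon> :: real^'n \<Rightarrow> real) \<in> borel_measurable borel"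
    by (intro borel_measurable_continuous_onI continuous_intros)
  have "has_bochner_integral (distr lborel borel ((+) (- c))) (gauss_delta \<epsilon>) 1"
    using gauss_delta_has_bochner_integral[OF assms] by (simp only: lborel_distr_plus)
  then show ?thesis
    using m by (simp add: has_bochner_integral_iff integrable_distr_eq integral_distr)
qed

text \<open>The consistency error, tested against a bounded field. The exponent \<open>3\<close> of \<open>\<epsilon>\<close> is that of the
  \<open>L\<^sup>1\<close> norm of third derivatives of the Gaussian, so the supremum of the test field, and not its
  \<open>L\<^sup>2\<close> norm, has to appear on the right.\<close>

lemma smoothed_force_error:
  fixes \<phi> :: "real^'n \<Rightarrow> real^'n"
  assumes "\<Omega> \<in> sets lebesgue" and "\<Delta> > 0" and "\<epsilon> > 0" and B: "\<And>x. norm (\<phi> x) \<le> B"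
  shows "\<bar>LINT x|lebesgue_on \<Omega>. (particle_force P x' \<Delta> \<epsilon> x - smoothed_force P x' \<Delta> \<epsilon> x) \<bullet> \<phi> x\<bar>
      \<le> (\<bar>P\<bar> * \<Delta> ^ CARD('n)) * (3 * CARD('n) * 2 ^ CARD('n) * (\<Delta>\<^sup>2 / \<epsilon> ^ 3)) * B"
proof -
  define K where "K i x = gauss_delta (2 * \<epsilon>) (x - x') +
    gauss_delta (2 * \<epsilon>) (x - x' + (\<Delta> / 2) *\<^sub>R axis i 1) +
    gauss_delta (2 * \<epsilon>) (x - x' - (\<Delta> / 2) *\<^sub>R axis i 1)" for i :: 'n and x
  define c where "c = 2 ^ CARD('n) * (\<Delta>\<^sup>2 / \<epsilon> ^ 3)"
  define F where "F x = particle_force P x' \<Delta> \<epsilon> x - smoothed_force P x' \<Delta> \<epsilon> x" for x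
  have B0: "B \<ge> 0" using B[of 0] norm_ge_zero order_trans by blast
  have c0: "c \<ge> 0" using assms by (simp add: c_def)
  have K0: "K i x \<ge> 0" for i x by (simp add: K_def)
  have F: "\<bar>F x $ i\<bar> \<le> (\<bar>P\<bar> * \<Delta> ^ CARD('n)) * (c * K i x)" for x i
  proof -
    \<comment> \<open>Component \<open>i\<close> of the error is a central difference error with step \<open>\<Delta> / 2\<close>.\<close>
    let ?R = "- ((x - x') $ i / \<epsilon> / \<epsilon>) * gauss_delta \<epsilon> (x - x') -
      (gauss_delta \<epsilon> (x - x' + (\<Delta> / 2) *\<^sub>R axis i 1) - gauss_delta \<epsilon> (x - x' - (\<Delta> / 2) *\<^sub>R axis i 1)) / (2 * (\<Delta> / 2))"
    have p: "\<Delta> ^ CARD('n) = \<Delta> ^ (CARD('n) - 1) * \<Delta>"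
      by (metis card_gt_0_iff finite UNIV_not_empty power_minus_mult)
    have "particle_force P x' \<Delta> \<epsilon> x $ i =
        P * \<Delta> ^ CARD('n) * (- ((x - x') $ i / \<epsilon> / \<epsilon>) * gauss_delta \<epsilon> (x - x'))"
      unfolding particle_force_def grad_def partial_gauss_delta[OF assms(3)] by simp
    moreover have "smoothed_force P x' \<Delta> \<epsilon> x $ i = P * \<Delta> ^ (CARD('n) - 1) *
        (gauss_delta \<epsilon> (x - x' + (\<Delta> / 2) *\<^sub>R axis i 1) - gauss_delta \<epsilon> (x - x' - (\<Delta> / 2) *\<^sub>R axis i 1))"
      unfolding smoothed_force_def by (simp add: axis_def if_distrib if_distribR cong: if_cong)
    moreover have "P * (a * \<Delta>) * X - P * a * Y = P * (a * \<Delta>) * (X - Y / (2 * (\<Delta> / 2)))" for a X Y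
      using assms(2) by (simp add: field_simps)
    ultimately have "F x $ i = P * \<Delta> ^ CARD('n) * ?R"
      unfolding F_def p vector_minus_component by metis
    moreover have "\<bar>?R\<bar> \<le> c * K i x"
      using gauss_delta_central_difference[OF assms(3), of "\<Delta> / 2" "x - x'" i] assms(2)
      by (simp add: c_def K_def power_divide field_simps)
    ultimately show ?thesis
      using assms(2) by (simp only: abs_mult) (auto intro!: mult_left_mono)
  qed
  have "has_bochner_integral lborel (\<lambda>x. gauss_delta (2 * \<epsilon>) (x - a)) 1" for a :: "real^'n"
    using assms by (intro gauss_delta_translate_has_bochner_integral) simp
  from this[of x'] this[of "x' - (\<Delta> / 2) *\<^sub>R axis i 1" for i] this[of "x' + (\<Delta> / 2) *\<^sub>R axis i 1" for i]
  have K: "has_bochner_integral lborel (K i) (1 + 1 + 1)" for i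
    unfolding K_def by (intro has_bochner_integral_add) (simp_all add: algebra_simps)
  have "has_bochner_integral lborel (\<lambda>x. (\<bar>P\<bar> * \<Delta> ^ CARD('n)) * c * (\<Sum>i\<in>UNIV. K i x) * B)
    ((\<bar>P\<bar> * \<Delta> ^ CARD('n)) * c * (\<Sum>i\<in>(UNIV::'n set). (1 + 1 + 1)) * B)"
    by (intro has_bochner_integral_mult_left has_bochner_integral_mult_right has_bochner_integral_sum K)
  note I = lebesgue_on_integral_le[OF assms(1) this]
  have nn: "0 \<le> (\<bar>P\<bar> * \<Delta> ^ CARD('n)) * c * (\<Sum>i\<in>UNIV. K i x) * B" for x
    using assms(2) c0 B0 by (intro mult_nonneg_nonneg sum_nonneg K0) auto
  have le: "\<bar>F x \<bullet> \<phi> x\<bar> \<le> (\<bar>P\<bar> * \<Delta> ^ CARD('n)) * c * (\<Sum>i\<in>UNIV. K i x) * B" for x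
  proof -
    have "\<bar>F x \<bullet> \<phi> x\<bar> \<le> norm (F x) * norm (\<phi> x)" by (rule Cauchy_Schwarz_ineq2)
    also have "\<dots> \<le> (\<Sum>i\<in>UNIV. \<bar>F x $ i\<bar>) * B"
      by (intro mult_mono norm_le_l1_cart B sum_nonneg) auto
    also have "\<dots> \<le> (\<Sum>i\<in>UNIV. (\<bar>P\<bar> * \<Delta> ^ CARD('n)) * (c * K i x)) * B"
      by (intro mult_right_mono sum_mono F B0)
    also have "\<dots> = (\<bar>P\<bar> * \<Delta> ^ CARD('n)) * c * (\<Sum>i\<in>UNIV. K i x) * B"
      by (simp add: sum_distrib_left mult.assoc)
    finally show ?thesis .
  qed
  have "\<bar>LINT x|lebesgue_on \<Omega>. F x \<bullet> \<phi> x\<bar> \<le> (LINT x|lebesgue_on \<Omega>. \<bar>F x \<bullet> \<phi> x\<bar>)"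
    using integral_norm_bound[of "lebesgue_on \<Omega>" "\<lambda>x. F x \<bullet> \<phi> x"] by simp
  also have "\<dots> \<le> (LINT x|lebesgue_on \<Omega>. (\<bar>P\<bar> * \<Delta> ^ CARD('n)) * c * (\<Sum>i\<in>UNIV. K i x) * B)"
    by (intro integral_mono' I(1) nn le)
  also have "\<dots> \<le> (\<bar>P\<bar> * \<Delta> ^ CARD('n)) * c * (\<Sum>i\<in>(UNIV::'n set). (1 + 1 + 1)) * B"
    by (intro I(2) nn)
  finally show ?thesis by (simp add: F_def c_def mult_ac)
qed

section \<open>Test functions and the fundamental lemma of the calculus of variations\<close>

lemma lebesgue_on_measurable:
  fixes f :: "real^'n \<Rightarrow> 'b::topological_space"
  assumes "f \<in> borel_measurable borel" shows "f \<in> borel_measurable (lebesgue_on S)"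
  using assms by (intro measurable_restrict_space1 measurable_completion) simp

lemma partial_eqI:
  fixes f :: "real^'n \<Rightarrow> real"
  assumes "(f has_derivative (\<lambda>h. g \<bullet> h)) (at x)"
  shows "partial f j x = g $ j"
  using frechet_derivative_at[OF assms, symmetric] by (simp add: partial_def inner_axis)

lemma test_functionI:
  fixes f :: "real^'n \<Rightarrow> real"
  assumes D: "\<And>x. (f has_derivative (\<lambda>h. g x \<bullet> h)) (at x)" and "continuous_on UNIV g"
    and "compact S" and "S \<subseteq> \<Omega>" and "\<And>x. x \<notin> S \<Longrightarrow> f x = 0"
  shows "test_function \<Omega> f"
proof -
  have "partial f j = (\<lambda>x. g x $ j)" for j
    by (rule ext) (rule partial_eqI[OF D])
  moreover have cl: "closure {x. f x \<noteq> 0} \<subseteq> S"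
    using assms(3,5) by (intro closure_minimal compact_imp_closed) auto
  moreover have "compact (closure {x. f x \<noteq> 0})"
    using compact_Int_closed[OF assms(3) closed_closure] cl by (metis inf.absorb_iff2)
  ultimately show ?thesis
    using D assms(2,4) unfolding test_function_def differentiable_def
    by (auto intro!: continuous_on_component)
qed

text \<open>Squaring the positive part makes it once continuously differentiable, which is all that
  \<open>test_function\<close> asks for.\<close>

lemma positive_part_square_has_derivative:
  "((\<lambda>t::real. (max 0 t)\<^sup>2) has_real_derivative 2 * max 0 t) (at t)"
proof -
  consider "t > 0" | "t < 0" | "t = 0" by linarith
  then show ?thesis
  proof cases
    case 1
    have "((\<lambda>t::real. t\<^sup>2) has_real_derivative 2 * max 0 t) (at t)"
      using 1 by (auto intro!: derivative_eq_intros)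
    then show ?thesis
      by (rule has_field_derivative_transform_within_open[where S = "{0<..}"]) (use 1 in auto)
  next
    case 2
    have "((\<lambda>t::real. 0) has_real_derivative 2 * max 0 t) (at t)"
      using 2 by (auto intro!: derivative_eq_intros)
    then show ?thesis
      by (rule has_field_derivative_transform_within_open[where S = "{..<0}"]) (use 2 in auto)
  next
    case 3
    have "((\<lambda>h::real. ((max 0 (0 + h))\<^sup>2 - (max 0 0)\<^sup>2) / h) \<longlongrightarrow> 0) (at 0)"
    proof (rule tendsto_0_le[where K = 1])
      show "((\<lambda>h::real. h) \<longlongrightarrow> 0) (at 0)" by (rule tendsto_ident_at)
      show "\<forall>\<^sub>F h::real in at 0. norm (((max 0 (0 + h))\<^sup>2 - (max 0 0)\<^sup>2) / h) \<le> norm h * 1"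
        by (auto simp: eventually_at_filter max_def power2_eq_square intro!: always_eventually)
    qed
    then show ?thesis using 3 by (simp add: DERIV_def)
  qed
qed

text \<open>A nonnegative, once continuously differentiable function that is positive exactly on a ball.\<close>

definition ball_bump :: "real^'n \<Rightarrow> real \<Rightarrow> real^'n \<Rightarrow> real" where
  "ball_bump c r x = (max 0 (r\<^sup>2 - (norm (x - c))\<^sup>2))\<^sup>2"

lemma ball_bump_nonneg: "ball_bump c r x \<ge> 0"
  by (simp add: ball_bump_def)

lemma ball_bump_pos_iff: "r > 0 \<Longrightarrow> ball_bump c r x > 0 \<longleftrightarrow> x \<in> ball c r"
proof -
  assume "r > 0"
  have "ball_bump c r x > 0 \<longleftrightarrow> (norm (x - c))\<^sup>2 < r\<^sup>2"
    by (auto simp: ball_bump_def max_def)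
  also have "\<dots> \<longleftrightarrow> norm (x - c) < r"
    using \<open>r > 0\<close> by (metis norm_ge_zero order_less_imp_le power2_less_imp_less power_strict_mono zero_less_numeral)
  finally show ?thesis by (simp add: dist_norm norm_minus_commute)
qed

lemma ball_bump_has_derivative:
  "(ball_bump c r has_derivative (\<lambda>h. ((- 4 * max 0 (r\<^sup>2 - (norm (x - c))\<^sup>2)) *\<^sub>R (x - c)) \<bullet> h)) (at x)"
proof -
  have "((\<lambda>x. r\<^sup>2 - (norm (x - c))\<^sup>2) has_derivative (\<lambda>h. - 2 * ((x - c) \<bullet> h))) (at x)"
    unfolding power2_norm_eq_inner by (auto intro!: derivative_eq_intros simp: inner_commute)
  from has_derivative_compose[OF this
      positive_part_square_has_derivative[unfolded has_field_derivative_def]]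
  show ?thesis
    unfolding ball_bump_def[abs_def] by (rule has_derivative_eq_rhs) (simp add: fun_eq_iff)
qed

text \<open>Every open set is a countable union of balls whose closures lie in it. The partial sums \<open>s k\<close> of
  the associated bumps are compactly supported, and \<open>k * s k / (1 + k * s k)\<close> tends to one where
  some bump is positive and vanishes elsewhere.\<close>

lemma test_functions_approximating_open:
  fixes U :: "(real^'n) set"
  assumes "open U"
  obtains \<phi> :: "nat \<Rightarrow> real^'n \<Rightarrow> real"
  where "\<And>k. test_function U (\<phi> k)" and "\<And>k x. 0 \<le> \<phi> k x" and "\<And>k x. \<phi> k x \<le> 1"
    and "\<And>x. (\<lambda>k. \<phi> k x) \<longlonglongrightarrow> indicator U x"
proof (cases "U = {}")
  case True
  show ?thesis
  proof (rule that[of "\<lambda>k x. 0"])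
    show "test_function U (\<lambda>x. 0)" for k :: nat
      by (rule test_functionI[where g = "\<lambda>x. 0" and S = "{}"]) auto
  qed (auto simp: True)
next
  case False
  define \<B> where "\<B> = {B. \<exists>c r. r > 0 \<and> B = ball c r \<and> cball c r \<subseteq> U}"
  have "\<Union>\<B> = U"
  proof
    show "\<Union>\<B> \<subseteq> U" unfolding \<B>_def using ball_subset_cball by blast
    show "U \<subseteq> \<Union>\<B>"
    proof
      fix x assume "x \<in> U"
      then obtain r where "r > 0" "cball x r \<subseteq> U" using assms open_contains_cball by blast
      then show "x \<in> \<Union>\<B>" unfolding \<B>_def by (auto intro!: exI[of _ "ball x r"])
    qed
  qed
  moreover obtain \<B>' where \<B>': "\<B>' \<subseteq> \<B>" "countable \<B>'" "\<Union>\<B>' = \<Union>\<B>"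
    using Lindelof[of \<B>] unfolding \<B>_def by blast
  ultimately have "\<B>' \<noteq> {}" "\<Union>\<B>' = U" using False by auto
  have "\<forall>i. \<exists>c r. r > 0 \<and> from_nat_into \<B>' i = ball c r \<and> cball c r \<subseteq> U"
    using from_nat_into[OF \<open>\<B>' \<noteq> {}\<close>] \<B>'(1) unfolding \<B>_def by blast
  then obtain c r where cr: "\<And>i::nat. r i > 0" "\<And>i. from_nat_into \<B>' i = ball (c i) (r i)"
      "\<And>i. cball (c i) (r i) \<subseteq> U"
    by metis
  have U: "U = (\<Union>i. ball (c i) (r i))"
    using range_from_nat_into[OF \<open>\<B>' \<noteq> {}\<close> \<B>'(2)] \<open>\<Union>\<B>' = U\<close> cr(2) by (metis (mono_tags, lifting) image_cong)
  define s where "s k x = (\<Sum>i<k. ball_bump (c i) (r i) x)" for k :: nat and x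
  define \<phi> where "\<phi> k x = real k * s k x / (1 + real k * s k x)" for k x
  define g where "g k x = (\<Sum>i<k. (- 4 * max 0 ((r i)\<^sup>2 - (norm (x - c i))\<^sup>2)) *\<^sub>R (x - c i))" for k :: nat and x
  have s0: "s k x \<ge> 0" for k x unfolding s_def by (intro sum_nonneg ball_bump_nonneg)
  have ks: "real k * s k x \<ge> 0" for k x using s0 by simp
  have s_zero: "s k x = 0" if "x \<notin> (\<Union>i<k. cball (c i) (r i))" for k x
    unfolding s_def
  proof (rule sum.neutral, rule ballI)
    fix i assume "i \<in> {..<k}"
    then have "x \<notin> ball (c i) (r i)" using that ball_subset_cball by blast
    then show "ball_bump (c i) (r i) x = 0"
      using ball_bump_pos_iff[OF cr(1)] ball_bump_nonneg by (metis order_less_le)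
  qed
  have ds: "(s k has_derivative (\<lambda>h. g k x \<bullet> h)) (at x)" for k x
    unfolding s_def[abs_def] g_def inner_sum_left
    by (intro has_derivative_sum ball_bump_has_derivative)
  show ?thesis
  proof (rule that[of \<phi>])
    fix k
    show "test_function U (\<phi> k)"
    proof (rule test_functionI[where g = "\<lambda>x. (real k / (1 + real k * s k x)\<^sup>2) *\<^sub>R g k x"])
      fix x
      have nz: "1 + real k * s k x \<noteq> 0" using ks[of k x] by linarith
      have "((\<lambda>t. real k * t / (1 + real k * t)) has_real_derivative real k / (1 + real k * s k x)\<^sup>2) (at (s k x))"
        using nz by (auto intro!: derivative_eq_intros simp: field_simps power2_eq_square)
      from has_derivative_compose[OF ds this[unfolded has_field_derivative_def]]
      show "(\<phi> k has_derivative (\<lambda>h. ((real k / (1 + real k * s k x)\<^sup>2) *\<^sub>R g k x) \<bullet> h)) (at x)"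
        unfolding \<phi>_def[abs_def] by simp
    next
      have "continuous_on UNIV (s k)"
        unfolding s_def[abs_def] ball_bump_def by (intro continuous_intros)
      moreover have "continuous_on UNIV (g k)"
        unfolding g_def[abs_def] by (intro continuous_intros)
      moreover have "1 + real k * s k x \<noteq> 0" for x using ks[of k x] by linarith
      ultimately show "continuous_on UNIV (\<lambda>x. (real k / (1 + real k * s k x)\<^sup>2) *\<^sub>R g k x)"
        by (intro continuous_intros) auto
    next
      show "compact (\<Union>i<k. cball (c i) (r i))" by (intro compact_UN) auto
      show "(\<Union>i<k. cball (c i) (r i)) \<subseteq> U" using cr(3) by blast
      show "\<phi> k x = 0" if "x \<notin> (\<Union>i<k. cball (c i) (r i))" for x
        using s_zero[OF that] by (simp add: \<phi>_def)
    qed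
    show "0 \<le> \<phi> k x" for x using ks[of k x] by (simp add: \<phi>_def)
    show "\<phi> k x \<le> 1" for x using ks[of k x] by (simp add: \<phi>_def divide_le_eq)
  next
    fix x
    show "(\<lambda>k. \<phi> k x) \<longlonglongrightarrow> indicator U x"
    proof (cases "x \<in> U")
      case False
      then have "\<phi> k x = 0" for k
        using s_zero[of x k] cr(3) by (force simp: \<phi>_def)
      then show ?thesis using False by simp
    next
      case True
      then obtain j where j: "x \<in> ball (c j) (r j)" using U by blast
      define b where "b = ball_bump (c j) (r j) x"
      have b: "b > 0" using j ball_bump_pos_iff[OF cr(1)[of j], of "c j" x] by (simp add: b_def)
      have low: "1 - 1 / (1 + real k * b) \<le> \<phi> k x" if "k > j" for k
      proof -
        have "b \<le> s k x"
          unfolding s_def b_def using that by (intro member_le_sum ball_bump_nonneg) auto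
        then have "1 / (1 + real k * s k x) \<le> 1 / (1 + real k * b)"
          using b by (intro divide_left_mono mult_pos_pos add_left_mono mult_left_mono) (auto simp: add_pos_nonneg s0)
        moreover have "\<phi> k x = 1 - 1 / (1 + real k * s k x)"
          using ks[of k x] by (simp add: \<phi>_def field_simps)
        ultimately show ?thesis by simp
      qed
      have "filterlim (\<lambda>k. 1 + real k * b) at_top sequentially"
        by (rule filterlim_tendsto_add_at_top[OF tendsto_const
              filterlim_at_top_mult_tendsto_pos[OF tendsto_const b filterlim_real_sequentially]])
      then have "(\<lambda>k. 1 / (1 + real k * b)) \<longlonglongrightarrow> 0"
        by (intro tendsto_divide_0[OF tendsto_const] filterlim_at_top_imp_at_infinity)
      from tendsto_diff[OF tendsto_const[of 1] this]
      have lim: "(\<lambda>k. 1 - 1 / (1 + real k * b)) \<longlonglongrightarrow> 1" by simp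
      have "(\<lambda>k. \<phi> k x) \<longlonglongrightarrow> 1"
      proof (rule tendsto_sandwich[OF _ _ lim tendsto_const])
        show "\<forall>\<^sub>F k in sequentially. 1 - 1 / (1 + real k * b) \<le> \<phi> k x"
          using low eventually_gt_at_top by (rule eventually_mono[rotated])
        show "\<forall>\<^sub>F k in sequentially. \<phi> k x \<le> 1"
        proof (rule always_eventually, rule allI)
          fix k show "\<phi> k x \<le> 1" using ks[of k x] by (simp add: \<phi>_def divide_le_eq)
        qed
      qed
      then show ?thesis using True by simp
    qed
  qed
qed

lemma test_function_mono: "test_function U \<phi> \<Longrightarrow> U \<subseteq> \<Omega> \<Longrightarrow> test_function \<Omega> \<phi>"
  by (auto simp: test_function_def)

lemma test_function_continuous: "test_function \<Omega> \<phi> \<Longrightarrow> continuous_on UNIV \<phi>"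
  unfolding test_function_def
  by (meson differentiable_at_imp_differentiable_on differentiable_imp_continuous_on)

lemma test_function_outside:
  assumes "test_function \<Omega> \<phi>" and "x \<notin> \<Omega>"
  shows "\<phi> x = 0" and "partial \<phi> j x = 0"
proof -
  have x: "x \<in> - closure {x. \<phi> x \<noteq> 0}" using assms by (auto simp: test_function_def)
  then show "\<phi> x = 0" using closure_subset[of "{x. \<phi> x \<noteq> 0}"] by auto
  have "(\<phi> has_derivative (\<lambda>h. 0)) (at x)"
    by (rule has_derivative_transform_within_open[where f = "\<lambda>x. 0", OF _ _ x])
      (use closure_subset[of "{x. \<phi> x \<noteq> 0}"] in auto)
  then have "(\<phi> has_derivative (\<lambda>h. 0 \<bullet> h)) (at x)" by simp
  from partial_eqI[OF this] show "partial \<phi> j x = 0" by simp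
qed

lemma test_function_bounded:
  assumes "test_function \<Omega> \<phi>"
  obtains B where "B > 0" "\<And>x. \<bar>\<phi> x\<bar> \<le> B" "\<And>x. \<bar>partial \<phi> j x\<bar> \<le> B"
proof -
  define S where "S = closure {x. \<phi> x \<noteq> 0}"
  have S: "compact S" "test_function S \<phi>" using assms by (auto simp: test_function_def S_def)
  have "bounded (\<phi> ` S)" "bounded (partial \<phi> j ` S)"
    using test_function_continuous[OF assms] assms S(1)
    by (auto intro!: compact_imp_bounded compact_continuous_image simp: test_function_def
        intro: continuous_on_subset)
  then obtain B1 B2 where "\<And>x. x \<in> S \<Longrightarrow> \<bar>\<phi> x\<bar> \<le> B1" "\<And>x. x \<in> S \<Longrightarrow> \<bar>partial \<phi> j x\<bar> \<le> B2"
    unfolding bounded_iff by (auto simp: image_iff)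
  then have "\<bar>\<phi> x\<bar> \<le> max 1 (max B1 B2)" "\<bar>partial \<phi> j x\<bar> \<le> max 1 (max B1 B2)" for x
    using test_function_outside[OF S(2), of x] by (cases "x \<in> S"; fastforce)+
  then show ?thesis using that[of "max 1 (max B1 B2)"] by auto
qed

lemma le_one_plus_square: fixes t :: real shows "t \<le> 1 + t\<^sup>2"
proof -
  have "0 \<le> (t - 1 / 2)\<^sup>2" by simp
  then show ?thesis by (simp add: power2_eq_square algebra_simps)
qed

lemma L2_field_integrable:
  fixes u :: "real^'n \<Rightarrow> 'b::euclidean_space"
  assumes "L2_field \<Omega> u" and "\<Omega> \<in> lmeasurable"
  shows "integrable (lebesgue_on \<Omega>) u"
proof -
  interpret finite_measure "lebesgue_on \<Omega>" using assms(2) by (rule finite_measure_lebesgue_on)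
  have "integrable (lebesgue_on \<Omega>) (\<lambda>x. 1 + (norm (u x))\<^sup>2)"
    using assms(1) by (auto simp: L2_field_def)
  then show ?thesis
    by (rule Bochner_Integration.integrable_bound)
      (use assms(1) le_one_plus_square in \<open>auto simp: L2_field_def\<close>)
qed

text \<open>Approximating indicators of open sets by test functions shows that \<open>g\<close> has integral zero over
  every open subset; a Dynkin system argument extends this to Borel sets, and completeness to all
  Lebesgue measurable sets.\<close>

lemma fundamental_lemma_calculus_of_variations:
  fixes g :: "real^'n \<Rightarrow> real"
  assumes "open \<Omega>" and "\<Omega> \<in> lmeasurable" and g: "integrable (lebesgue_on \<Omega>) g"
    and 0: "\<And>\<phi>. test_function \<Omega> \<phi> \<Longrightarrow> (LINT x|lebesgue_on \<Omega>. g x * \<phi> x) = 0"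
  shows "AE x in lebesgue_on \<Omega>. g x = 0"
proof -
  let ?M = "lebesgue_on \<Omega>"
  interpret finite_measure ?M using assms(2) by (rule finite_measure_lebesgue_on)
  have \<Omega>: "\<Omega> \<in> sets lebesgue" using assms(1) by (simp add: borel_open)
  have ind: "indicator A \<in> borel_measurable ?M" if "A \<in> sets borel" for A :: "(real^'n) set"
    using that by (intro measurable_restrict_space1 borel_measurable_indicator) auto
  have int: "integrable ?M (\<lambda>x. indicator A x * g x)" if "A \<in> sets borel" for A :: "(real^'n) set"
  proof (rule Bochner_Integration.integrable_bound[OF g])
    show "(\<lambda>x. indicator A x * g x) \<in> borel_measurable ?M"
      using ind[OF that] g by (intro borel_measurable_times) auto
  qed (auto simp: indicator_def)
  define Q where "Q A \<longleftrightarrow> (LINT x|?M. indicator A x * g x) = 0" for A :: "(real^'n) set"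
  have Q_open: "Q U" if "open U" for U
  proof -
    have "open (U \<inter> \<Omega>)" using that assms(1) by blast
    then obtain \<phi> where \<phi>: "\<And>k. test_function (U \<inter> \<Omega>) (\<phi> k)" "\<And>k x. 0 \<le> \<phi> k x" "\<And>k x. \<phi> k x \<le> 1"
      "\<And>x. (\<lambda>k. \<phi> k x) \<longlonglongrightarrow> indicator (U \<inter> \<Omega>) x"
      using test_functions_approximating_open by blast
    have "(\<lambda>k. LINT x|?M. g x * \<phi> k x) \<longlonglongrightarrow> (LINT x|?M. g x * indicator (U \<inter> \<Omega>) x)"
    proof (rule integral_dominated_convergence[where w = "\<lambda>x. \<bar>g x\<bar>"])
      have "\<phi> k \<in> borel_measurable ?M" for k
        using test_function_continuous[OF \<phi>(1)]
        by (intro measurable_restrict_space1 measurable_completion) (simp add: borel_measurable_continuous_onI)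
      then show "(\<lambda>x. g x * \<phi> k x) \<in> borel_measurable ?M" for k using g by simp
      show "(\<lambda>x. g x * indicator (U \<inter> \<Omega>) x) \<in> borel_measurable ?M"
        using g ind[OF borel_open[OF \<open>open (U \<inter> \<Omega>)\<close>]] by (intro borel_measurable_times) auto
      show "AE x in ?M. (\<lambda>k. g x * \<phi> k x) \<longlonglongrightarrow> g x * indicator (U \<inter> \<Omega>) x"
        by (intro AE_I2 tendsto_intros \<phi>)
      show "AE x in ?M. norm (g x * \<phi> k x) \<le> \<bar>g x\<bar>" for k
        using \<phi>(2,3)[of k] by (intro AE_I2) (simp add: abs_mult mult_left_le)
    qed (use g in auto)
    moreover have "(LINT x|?M. g x * \<phi> k x) = 0" for k
      using 0[OF test_function_mono[OF \<phi>(1)]] by simp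
    ultimately have "(LINT x|?M. g x * indicator (U \<inter> \<Omega>) x) = 0"
      by (simp add: LIMSEQ_const_iff)
    moreover have "(LINT x|?M. g x * indicator (U \<inter> \<Omega>) x) = (LINT x|?M. indicator U x * g x)"
      by (rule Bochner_Integration.integral_cong) (auto simp: indicator_def)
    ultimately show ?thesis by (simp add: Q_def)
  qed
  have Q_borel: "Q A" if "A \<in> sets borel" for A
  proof -
    have "Int_stable {S::(real^'n) set. open S}" "{S::(real^'n) set. open S} \<subseteq> Pow UNIV"
      by (auto simp: Int_stable_def)
    moreover have "A \<in> sigma_sets UNIV {S. open S}"
      using that by (simp add: borel_def)
    ultimately show ?thesis
    proof (induct A rule: sigma_sets_induct_disjoint)
      case (basic A)
      then show ?case using Q_open by simp
    next
      case empty
      show ?case by (simp add: Q_def)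
    next
      case (compl A)
      then have "A \<in> sets borel" by (simp add: borel_def)
      then have "(LINT x|?M. indicator UNIV x * g x - indicator A x * g x) = 0"
        using Q_open[of UNIV] compl(2) int[of UNIV] int[of A] by (subst Bochner_Integration.integral_diff) (auto simp: Q_def)
      moreover have "indicator (UNIV - A) x * g x = indicator UNIV x * g x - indicator A x * g x" for x
        by (simp add: indicator_def)
      ultimately show ?case by (simp add: Q_def)
    next
      case (union A)
      have A: "A i \<in> sets borel" for i using union(2) by (auto simp: borel_def)
      have "(\<lambda>k. LINT x|?M. indicator (\<Union>i<k. A i) x * g x) \<longlonglongrightarrow> (LINT x|?M. indicator (\<Union>i. A i) x * g x)"
      proof (rule integral_dominated_convergence[where w = "\<lambda>x. \<bar>g x\<bar>"])
        show "(\<lambda>x. indicator (\<Union>i. A i) x * g x) \<in> borel_measurable ?M"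
          using int[of "\<Union>i. A i"] A by auto
        show "(\<lambda>x. indicator (\<Union>i<k. A i) x * g x) \<in> borel_measurable ?M" for k
          using int[of "\<Union>i<k. A i"] A by auto
        show "AE x in ?M. (\<lambda>k. indicator (\<Union>i<k. A i) x * g x) \<longlonglongrightarrow> indicator (\<Union>i. A i) x * g x"
          by (intro AE_I2 tendsto_intros LIMSEQ_indicator_UN)
      qed (use g in \<open>auto simp: indicator_def\<close>)
      moreover have "(LINT x|?M. indicator (\<Union>i<k. A i) x * g x) = 0" for k
      proof (induct k)
        case (Suc k)
        have "x \<notin> A k" if "i < k" "x \<in> A i" for i x
          using union(1) that unfolding disjoint_family_on_def by (metis UNIV_I disjoint_iff order_less_irrefl)
        then have "indicator (\<Union>i<Suc k. A i) x * g x = indicator (A k) x * g x + indicator (\<Union>i<k. A i) x * g x" for x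
          by (auto simp: lessThan_Suc indicator_def)
        then show ?case
          using Suc union(3)[of k] int[of "A k"] int[of "\<Union>i<k. A i"] A by (auto simp: Q_def)
      qed simp
      ultimately show ?case
        by (simp add: Q_def LIMSEQ_const_iff)
    qed
  qed
  have "AE x in ?M. g x = 0"
  proof (rule density_zero[OF g])
    fix A assume "A \<in> sets ?M"
    then have A: "A \<in> sets lebesgue" "A \<subseteq> \<Omega>" using \<Omega> by (auto simp: sets_restrict_space_iff)
    obtain S N N' where S: "A = S \<union> N" "N \<subseteq> N'" "N' \<in> null_sets lborel" "S \<in> sets lborel"
      using sets_completionE[OF A(1)] by blast
    have "AE x in lebesgue. x \<notin> N'"
      using AE_not_in[OF S(3)] by (rule AE_completion)
    then have "AE x in ?M. x \<notin> N'"
      using \<Omega> by (auto simp: AE_restrict_space_iff elim: eventually_mono)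
    then have ae: "AE x in ?M. indicator A x * g x = indicator S x * g x"
      by (rule AE_mp) (use S(1,2) in \<open>auto simp: indicator_def intro!: AE_I2\<close>)
    have mS: "(\<lambda>x. indicator S x * g x) \<in> borel_measurable ?M"
      using int[of S] S(4) by auto
    have mA: "(\<lambda>x. indicator A x * g x) \<in> borel_measurable ?M"
      using \<open>A \<in> sets ?M\<close> g by auto
    have "(LINT x|?M. indicator A x * g x) = (LINT x|?M. indicator S x * g x)"
      by (rule integral_cong_AE[OF mA mS ae])
    also have "\<dots> = 0" using Q_borel S(4) by (simp add: Q_def)
    finally show "set_lebesgue_integral ?M A g = 0"
      by (simp add: set_lebesgue_integral_def)
  qed
  then show ?thesis .
qed

section \<open>Weak gradients of Lipschitz functions\<close>

lemma has_weak_gradient_unique: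
  fixes u :: "real^'n \<Rightarrow> real^'n"
  assumes "open \<Omega>" and "bounded \<Omega>" and "has_weak_gradient \<Omega> u G" and "has_weak_gradient \<Omega> u H"
  shows "AE x in lebesgue_on \<Omega>. G x = H x"
proof -
  have \<Omega>: "\<Omega> \<in> lmeasurable" using assms(1,2) by (simp add: lmeasurable_open)
  have GH: "integrable (lebesgue_on \<Omega>) G" "integrable (lebesgue_on \<Omega>) H"
    using assms(3,4) \<Omega> by (auto simp: has_weak_gradient_def intro: L2_field_integrable)
  have comp: "integrable (lebesgue_on \<Omega>) (\<lambda>x. F x $ i $ j)"
    if "integrable (lebesgue_on \<Omega>) F" for F :: "real^'n \<Rightarrow> real^'n^'n" and i j
    using integrable_bounded_linear[OF bounded_linear_compose[OF bounded_linear_vec_nth bounded_linear_vec_nth] that]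
    by simp
  have "AE x in lebesgue_on \<Omega>. G x $ i $ j - H x $ i $ j = 0" for i j
  proof (rule fundamental_lemma_calculus_of_variations[OF assms(1) \<Omega>])
    show "integrable (lebesgue_on \<Omega>) (\<lambda>x. G x $ i $ j - H x $ i $ j)"
      by (intro Bochner_Integration.integrable_diff comp GH)
    fix \<phi> :: "real^'n \<Rightarrow> real" assume \<phi>: "test_function \<Omega> \<phi>"
    obtain B where B: "\<And>x. \<bar>\<phi> x\<bar> \<le> B" using test_function_bounded[OF \<phi>] by metis
    have m: "\<phi> \<in> borel_measurable (lebesgue_on \<Omega>)"
      using test_function_continuous[OF \<phi>]
      by (intro measurable_restrict_space1 measurable_completion) (simp add: borel_measurable_continuous_onI)
    have int: "integrable (lebesgue_on \<Omega>) (\<lambda>x. F x $ i $ j * \<phi> x)"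
      if "integrable (lebesgue_on \<Omega>) F" for F :: "real^'n \<Rightarrow> real^'n^'n"
    proof (rule Bochner_Integration.integrable_bound)
      show "integrable (lebesgue_on \<Omega>) (\<lambda>x. F x $ i $ j * B)" using comp[OF that] by simp
      show "(\<lambda>x. F x $ i $ j * \<phi> x) \<in> borel_measurable (lebesgue_on \<Omega>)"
        using comp[OF that, of i j] m by (intro borel_measurable_times) auto
      show "AE x in lebesgue_on \<Omega>. norm (F x $ i $ j * \<phi> x) \<le> norm (F x $ i $ j * B)"
        using B by (intro AE_I2) (auto simp: abs_mult intro!: mult_left_mono order_trans[OF B abs_ge_self])
    qed
    have "(LINT x|lebesgue_on \<Omega>. u x $ i * partial \<phi> j x) = - (LINT x|lebesgue_on \<Omega>. F x $ i $ j * \<phi> x)"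
      if "has_weak_gradient \<Omega> u F" for F
      using that \<phi> unfolding has_weak_gradient_def by blast
    from this[OF assms(3)] this[OF assms(4)] show "(LINT x|lebesgue_on \<Omega>. (G x $ i $ j - H x $ i $ j) * \<phi> x) = 0"
      using int[OF GH(1)] int[OF GH(2)] by (simp add: left_diff_distrib)
  qed
  then have "AE x in lebesgue_on \<Omega>. \<forall>i\<in>UNIV. \<forall>j\<in>UNIV. G x $ i $ j - H x $ i $ j = 0"
    by (intro AE_finite_allI) auto
  then show ?thesis
    by eventually_elim (simp add: vec_eq_iff)
qed

lemma weak_grad_AE_eq:
  fixes u :: "real^'n \<Rightarrow> real^'n"
  assumes "open \<Omega>" and "bounded \<Omega>" and "has_weak_gradient \<Omega> u G"
  shows "AE x in lebesgue_on \<Omega>. weak_grad \<Omega> u x = G x"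
  using has_weak_gradient_unique[OF assms(1,2) _ assms(3)] someI[of "has_weak_gradient \<Omega> u", OF assms(3)]
  unfolding weak_grad_def by blast

text \<open>The integral of a difference quotient of \<open>u * \<phi>\<close> over the whole space vanishes by translation
  invariance. The quotients are dominated because \<open>u * \<phi>\<close> is Lipschitz in direction \<open>j\<close> with bounded
  support, and they converge almost everywhere to \<open>u * partial \<phi> j + G * \<phi>\<close>.\<close>

lemma integration_by_parts_Lipschitz:
  fixes u G :: "real^'n \<Rightarrow> real"
  assumes "bounded \<Omega>" and "continuous_on UNIV u" and u0: "\<And>x. x \<notin> \<Omega> \<Longrightarrow> u x = 0"
    and lip: "\<And>x t. \<bar>u (x + t *\<^sub>R axis j 1) - u x\<bar> \<le> L * \<bar>t\<bar>"
    and G: "G \<in> borel_measurable lebesgue" "\<And>x. \<bar>G x\<bar> \<le> L"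
    and deriv: "AE x in lebesgue. ((\<lambda>t. u (x + t *\<^sub>R axis j 1)) has_real_derivative G x) (at 0)"
    and "\<Omega> \<in> sets lebesgue" and \<phi>: "test_function \<Omega> \<phi>"
  shows "(LINT x|lebesgue_on \<Omega>. u x * partial \<phi> j x) = - (LINT x|lebesgue_on \<Omega>. G x * \<phi> x)"
proof -
  let ?e = "axis j 1 :: real^'n"
  obtain R where R: "R > 0" "\<And>x. x \<in> \<Omega> \<Longrightarrow> norm x \<le> R" using assms(1) bounded_pos by blast
  obtain B where B: "B > 0" "\<And>x. \<bar>\<phi> x\<bar> \<le> B" "\<And>x. \<bar>partial \<phi> j x\<bar> \<le> B"
    using test_function_bounded[OF \<phi>] by metis
  have L0: "L \<ge> 0" using G(2)[of 0] by linarith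
  have cphi: "continuous_on UNIV \<phi>" using \<phi> by (rule test_function_continuous)
  have "bounded (range u)"
  proof -
    have "bounded (u ` cball 0 R)"
      using assms(2) by (intro compact_imp_bounded compact_continuous_image continuous_on_subset[OF assms(2)]) auto
    moreover have "range u \<subseteq> insert 0 (u ` cball 0 R)" using u0 R(2) by fastforce
    ultimately show ?thesis using bounded_subset bounded_insert by metis
  qed
  then obtain U where U: "U > 0" "\<And>x. \<bar>u x\<bar> \<le> U" unfolding bounded_pos by (auto simp: image_iff)
  define p where "p x = u x * \<phi> x" for x
  define h where "h k = 1 / (real k + 1)" for k :: nat
  have h: "h k > 0" "h k \<le> 1" for k by (auto simp: h_def divide_simps)
  have h0: "h \<longlonglongrightarrow> 0" unfolding h_def using LIMSEQ_inverse_real_of_nat by (simp add: inverse_eq_divide add.commute)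
  define D where "D k x = (p (x + h k *\<^sub>R ?e) - p x) / h k" for k x
  define F where "F x = u x * partial \<phi> j x + G x * \<phi> x" for x
  define C where "C = L * B + U * B"
  have C0: "C \<ge> 0" unfolding C_def using L0 B(1) U(1) by simp
  have cp: "continuous_on UNIV p" unfolding p_def[abs_def] by (intro continuous_intros assms(2) cphi)
  have p0: "p x = 0" if "x \<notin> \<Omega>" for x using u0[OF that] by (simp add: p_def)
  have mp: "p \<in> borel_measurable borel" using cp by (rule borel_measurable_continuous_onI)
  have dphi: "((\<lambda>t. \<phi> (x + t *\<^sub>R ?e)) has_real_derivative partial \<phi> j (x + t *\<^sub>R ?e)) (at t)" for x t
    using \<phi> by (intro directional_derivative_eq_partial) (simp add: test_function_def)
  have philip: "\<bar>\<phi> (x + t *\<^sub>R ?e) - \<phi> x\<bar> \<le> B * \<bar>t\<bar>" for x t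
  proof -
    have "norm ((\<lambda>t. \<phi> (x + t *\<^sub>R ?e)) t - (\<lambda>t. \<phi> (x + t *\<^sub>R ?e)) 0) \<le> B * norm (t - 0)"
      by (rule field_differentiable_bound[where S = UNIV and f' = "\<lambda>t. partial \<phi> j (x + t *\<^sub>R ?e)"])
        (use dphi B(3) in auto)
    then show ?thesis by simp
  qed
  have plip: "\<bar>p (x + t *\<^sub>R ?e) - p x\<bar> \<le> C * \<bar>t\<bar>" for x t
  proof -
    have "p (x + t *\<^sub>R ?e) - p x = (u (x + t *\<^sub>R ?e) - u x) * \<phi> (x + t *\<^sub>R ?e) + u x * (\<phi> (x + t *\<^sub>R ?e) - \<phi> x)"
      by (simp add: p_def algebra_simps)
    then have "\<bar>p (x + t *\<^sub>R ?e) - p x\<bar> \<le> \<bar>u (x + t *\<^sub>R ?e) - u x\<bar> * \<bar>\<phi> (x + t *\<^sub>R ?e)\<bar> + \<bar>u x\<bar> * \<bar>\<phi> (x + t *\<^sub>R ?e) - \<phi> x\<bar>"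
      by (metis abs_mult abs_triangle_ineq)
    also have "\<dots> \<le> (L * \<bar>t\<bar>) * B + U * (B * \<bar>t\<bar>)"
      using L0 U(1) by (intro add_mono mult_mono lip B U philip) auto
    finally show ?thesis by (simp add: C_def algebra_simps)
  qed
  have mD: "D k \<in> borel_measurable borel" for k
    unfolding D_def[abs_def]
    by (intro borel_measurable_continuous_onI continuous_intros continuous_on_compose2[OF cp]) (use h(1)[of k] in auto)
  have bound: "\<bar>D k x\<bar> \<le> C * indicator (cball 0 (R + 1)) x" for k x
  proof (cases "x \<in> cball 0 (R + 1)")
    case True
    then show ?thesis using plip[of x "h k"] h(1)[of k] by (simp add: D_def divide_le_eq)
  next
    case False
    have "norm x \<le> norm (x + h k *\<^sub>R ?e) + h k"
      using norm_triangle_ineq4[of "x + h k *\<^sub>R ?e" "h k *\<^sub>R ?e"] h(1)[of k] by simp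
    then have "x \<notin> \<Omega>" "x + h k *\<^sub>R ?e \<notin> \<Omega>"
      using False R(2)[of x] R(2)[of "x + h k *\<^sub>R ?e"] h(2)[of k] by auto
    then show ?thesis using False by (simp add: D_def p0)
  qed
  have intball: "integrable lborel (\<lambda>x. K * indicator (cball (0::real^'n) r) x)" for K r :: real
    using emeasure_lborel_cball_finite[of "0::real^'n" r]
    by (intro integrable_mult_right integrable_real_indicator) auto
  have ball_bound: "norm (a * b) \<le> norm (K * B * indicator (cball 0 R) x)"
    if "\<bar>a\<bar> \<le> K" "\<bar>b\<bar> \<le> B" "x \<notin> \<Omega> \<Longrightarrow> a * b = 0" for a b K :: real and x
  proof (cases "x \<in> \<Omega>")
    case True
    have "\<bar>a\<bar> * \<bar>b\<bar> \<le> K * B" using that(1,2) by (intro mult_mono) auto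
    moreover have "K \<ge> 0" using that(1) by linarith
    ultimately show ?thesis using R(2)[OF True] B(1) by (simp add: abs_mult)
  next
    case False
    then have "a * b = 0" using that(3) by blast
    then show ?thesis by (simp only: norm_zero norm_ge_zero)
  qed
  have ip: "integrable lborel p"
  proof (rule Bochner_Integration.integrable_bound[OF intball[of "U * B" R]])
    show "AE x in lborel. norm (p x) \<le> norm (U * B * indicator (cball 0 R) x)"
      unfolding p_def by (intro AE_I2 ball_bound U B) (use u0 in auto)
  qed (use mp in simp)
  have int0: "(LINT x|lebesgue. D k x) = 0" for k
  proof -
    have ishift: "integrable lborel (\<lambda>x. p (x + h k *\<^sub>R ?e)) \<and> (LINT x|lborel. p (x + h k *\<^sub>R ?e)) = (LINT x|lborel. p x)"
    proof -
      have "has_bochner_integral (distr lborel borel ((+) (h k *\<^sub>R ?e))) p (LINT x|lborel. p x)"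
        using ip by (simp only: lborel_distr_plus has_bochner_integral_iff)
      then show ?thesis
        using mp by (simp add: has_bochner_integral_iff integrable_distr_eq integral_distr add.commute)
    qed
    have "(LINT x|lborel. D k x) = 0"
      unfolding D_def using ip ishift by simp
    then show ?thesis using mD[of k] by (simp add: integral_completion)
  qed
  have limD: "AE x in lebesgue. (\<lambda>k. D k x) \<longlonglongrightarrow> F x"
    using deriv
  proof eventually_elim
    case (elim x)
    have "((\<lambda>t. u (x + t *\<^sub>R ?e) * \<phi> (x + t *\<^sub>R ?e)) has_real_derivative F x) (at 0)"
      by (rule DERIV_cong[OF DERIV_mult[OF elim dphi[of x 0]]]) (simp add: F_def algebra_simps)
    then have "((\<lambda>t. (p (x + t *\<^sub>R ?e) - p x) / t) \<longlongrightarrow> F x) (at 0)"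
      by (simp add: DERIV_def p_def)
    moreover have "filterlim h (at 0) sequentially"
      using h0 h(1) by (simp add: filterlim_at less_imp_neq[symmetric] order_less_imp_not_eq2)
    ultimately show ?case
      unfolding D_def by (rule filterlim_compose)
  qed
  have cdp: "continuous_on UNIV (partial \<phi> j)" using \<phi> by (simp add: test_function_def)
  have ml: "f \<in> borel_measurable lebesgue" if "continuous_on UNIV f" for f :: "real^'n \<Rightarrow> real"
    using that by (intro measurable_completion) (simp add: borel_measurable_continuous_onI)
  have mF: "F \<in> borel_measurable lebesgue"
    unfolding F_def[abs_def] using assms(2) cphi cdp ml G(1)
    by (intro borel_measurable_add borel_measurable_times) auto
  have iball: "integrable lebesgue (\<lambda>x. K * indicator (cball (0::real^'n) r) x)" for K r :: real
    using intball[of K r] by (subst integrable_completion) auto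
  have "(\<lambda>k. LINT x|lebesgue. D k x) \<longlonglongrightarrow> (LINT x|lebesgue. F x)"
    by (rule integral_dominated_convergence[OF mF _ iball limD])
      (use mD bound in \<open>auto intro!: measurable_completion AE_I2\<close>)
  then have F0: "(LINT x|lebesgue. F x) = 0" by (simp add: int0 LIMSEQ_const_iff)
  have i1: "integrable lebesgue (\<lambda>x. u x * partial \<phi> j x)"
  proof (rule Bochner_Integration.integrable_bound[OF iball[of "U * B" R]])
    show "AE x in lebesgue. norm (u x * partial \<phi> j x) \<le> norm (U * B * indicator (cball 0 R) x)"
      by (intro AE_I2 ball_bound U B) (use u0 in auto)
  qed (use assms(2) cdp ml in \<open>auto intro!: borel_measurable_times\<close>)
  have i2: "integrable lebesgue (\<lambda>x. G x * \<phi> x)"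
  proof (rule Bochner_Integration.integrable_bound[OF iball[of "L * B" R]])
    show "AE x in lebesgue. norm (G x * \<phi> x) \<le> norm (L * B * indicator (cball 0 R) x)"
      by (intro AE_I2 ball_bound G B) (use test_function_outside(1)[OF \<phi>] in auto)
  qed (use cphi ml G(1) in \<open>auto intro!: borel_measurable_times\<close>)
  have "(LINT x|lebesgue. u x * partial \<phi> j x) + (LINT x|lebesgue. G x * \<phi> x) = 0"
    using F0 i1 i2 by (simp add: F_def)
  moreover have "(LINT x|lebesgue_on \<Omega>. f x) = (LINT x|lebesgue. f x)"
    if "\<And>x. x \<notin> \<Omega> \<Longrightarrow> f x = 0" for f :: "real^'n \<Rightarrow> real"
  proof -
    have "indicator \<Omega> x *\<^sub>R f x = f x" for x using that[of x] by (cases "x \<in> \<Omega>") auto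
    then have "(\<lambda>x. indicator \<Omega> x *\<^sub>R f x) = f" by (rule ext)
    then show ?thesis
      using integral_restrict_space[of \<Omega> lebesgue f] \<open>\<Omega> \<in> sets lebesgue\<close> by simp
  qed
  ultimately show ?thesis
    using u0 test_function_outside(1)[OF \<phi>] by simp
qed

section \<open>Continuous piecewise affine fields\<close>

text \<open>The properties of a finite element mesh that matter for the analysis of piecewise affine fields.
  Beyond convexity, neither the shape of the cells nor the way in which they intersect is used.\<close>

locale affine_mesh =
  fixes \<Omega> :: "(real^'n) set" and \<T> :: "(real^'n) set set"
  assumes open_domain: "open \<Omega>" and bounded_domain: "bounded \<Omega>"
    and finite_mesh: "finite \<T>"
    and compact_cell: "K \<in> \<T> \<Longrightarrow> compact K" and convex_cell: "K \<in> \<T> \<Longrightarrow> convex K"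
    and interior_cell: "K \<in> \<T> \<Longrightarrow> interior K \<noteq> {}"
    and mesh_subset: "\<Union>\<T> \<subseteq> closure \<Omega>"
begin

text \<open>Continuous fields on the whole space that are affine on each cell and vanish off the domain and off
  the mesh. This class contains the finite element space.\<close>

definition pw_affine :: "(real^'n \<Rightarrow> real^'n) set" where
  "pw_affine = {w. continuous_on UNIV w \<and> (\<forall>x. x \<notin> \<Omega> \<longrightarrow> w x = 0) \<and> (\<forall>x. x \<notin> \<Union>\<T> \<longrightarrow> w x = 0) \<and>
     (\<forall>K\<in>\<T>. \<exists>A b. \<forall>x\<in>K. w x = A *v x + b)}"

text \<open>The union of the cell boundaries: a closed null set off which every piecewise affine field is
  differentiable.\<close>

definition skeleton :: "(real^'n) set" where
  "skeleton = (\<Union>K\<in>\<T>. frontier K)"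

text \<open>The classical gradient off the skeleton. The value zero on the skeleton makes \<open>pw_grad\<close> bounded,
  Borel measurable, and linear in the field at every point.\<close>

definition pw_grad :: "(real^'n \<Rightarrow> real^'n) \<Rightarrow> real^'n \<Rightarrow> real^'n^'n" where
  "pw_grad w x = (if x \<in> skeleton then 0 else matrix (frechet_derivative w (at x)))"

lemma pw_affine_continuous: "w \<in> pw_affine \<Longrightarrow> continuous_on UNIV w"
  and pw_affine_zero: "w \<in> pw_affine \<Longrightarrow> x \<notin> \<Omega> \<Longrightarrow> w x = 0"
  and pw_affine_zero_mesh: "w \<in> pw_affine \<Longrightarrow> x \<notin> \<Union>\<T> \<Longrightarrow> w x = 0"
  unfolding pw_affine_def by blast+

lemma pw_affine_cellE:
  assumes "w \<in> pw_affine" and "K \<in> \<T>"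
  obtains A b where "\<And>x. x \<in> K \<Longrightarrow> w x = A *v x + b"
proof -
  have "\<exists>A b. \<forall>x\<in>K. w x = A *v x + b"
    using assms unfolding pw_affine_def by simp
  then show ?thesis using that by auto
qed

lemma pw_affineI:
  assumes "continuous_on UNIV w" and "\<And>x. x \<notin> \<Omega> \<Longrightarrow> w x = 0" and "\<And>x. x \<notin> \<Union>\<T> \<Longrightarrow> w x = 0"
    and "\<And>K. K \<in> \<T> \<Longrightarrow> \<exists>A b. \<forall>x\<in>K. w x = A *v x + b"
  shows "w \<in> pw_affine"
  using assms by (simp only: pw_affine_def mem_Collect_eq) simp

lemma zero_pw_affine: "(\<lambda>x. 0) \<in> pw_affine"
  by (rule pw_affineI) (auto intro!: exI[of _ 0])

lemma add_pw_affine: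
  assumes "v \<in> pw_affine" and "w \<in> pw_affine"
  shows "(\<lambda>x. v x + w x) \<in> pw_affine"
proof -
  have "\<exists>A b. \<forall>x\<in>K. v x + w x = A *v x + b" if K: "K \<in> \<T>" for K
  proof -
    obtain A b where 1: "\<And>x. x \<in> K \<Longrightarrow> v x = A *v x + b" using pw_affine_cellE[OF assms(1) K] by blast
    obtain A' b' where 2: "\<And>x. x \<in> K \<Longrightarrow> w x = A' *v x + b'" using pw_affine_cellE[OF assms(2) K] by blast
    show ?thesis
      by (rule exI[of _ "A + A'"], rule exI[of _ "b + b'"])
        (simp add: 1 2 matrix_vector_mult_add_rdistrib)
  qed
  then show ?thesis
    using assms
    by (intro pw_affineI)
      (simp_all add: pw_affine_continuous pw_affine_zero pw_affine_zero_mesh continuous_on_add del: Union_iff)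
qed

lemma scaleR_pw_affine:
  assumes "w \<in> pw_affine"
  shows "(\<lambda>x. c *\<^sub>R w x) \<in> pw_affine"
proof -
  have "\<exists>A b. \<forall>x\<in>K. c *\<^sub>R w x = A *v x + b" if K: "K \<in> \<T>" for K
  proof -
    obtain A b where 1: "\<And>x. x \<in> K \<Longrightarrow> w x = A *v x + b" using pw_affine_cellE[OF assms(1) K] by blast
    show ?thesis
      by (rule exI[of _ "c *\<^sub>R A"], rule exI[of _ "c *\<^sub>R b"])
        (simp add: 1 scaleR_add_right scaleR_matrix_vector_assoc)
  qed
  then show ?thesis
    using assms
    by (intro pw_affineI)
      (simp_all add: pw_affine_continuous pw_affine_zero pw_affine_zero_mesh continuous_on_scaleR del: Union_iff)
qed

lemma closed_skeleton: "closed skeleton"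
  unfolding skeleton_def using finite_mesh by (intro closed_UN) auto

lemma negligible_skeleton: "negligible skeleton"
  unfolding skeleton_def using finite_mesh convex_cell
  by (intro negligible_Union) (auto intro: negligible_convex_frontier)

lemma AE_not_skeleton: "AE x in lebesgue. x \<notin> skeleton"
  using negligible_skeleton by (intro AE_not_in) (simp add: negligible_iff_null_sets)

lemma skeleton_cases:
  assumes "x \<notin> skeleton"
  obtains K where "K \<in> \<T>" "x \<in> interior K" | "x \<in> - \<Union>\<T>"
proof (cases "x \<in> \<Union>\<T>")
  case True
  then obtain K where K: "K \<in> \<T>" "x \<in> K" by blast
  then have "x \<in> interior K"
    using assms compact_cell[OF K(1)] by (auto simp: skeleton_def frontier_def closure_closed compact_imp_closed)
  then show ?thesis using that K by blast
qed (use that in auto)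

lemma open_mesh_complement: "open (- \<Union>\<T>)"
  using finite_mesh compact_cell by (intro open_Compl closed_Union) (auto intro: compact_imp_closed)

lemma affine_on_cell_has_derivative:
  fixes A :: "real^'n^'n"
  assumes "x \<in> interior K" and "\<And>x. x \<in> K \<Longrightarrow> w x = A *v x + b"
  shows "(w has_derivative (\<lambda>h. A *v h)) (at x)"
proof -
  have "((\<lambda>x. A *v x + b) has_derivative (\<lambda>h. A *v h)) (at x)"
    by (auto intro!: derivative_eq_intros bounded_linear.has_derivative[OF matrix_vector_mul_bounded_linear])
  then show ?thesis
    by (rule has_derivative_transform_within_open[OF _ open_interior assms(1)])
      (use assms(2) interior_subset in fastforce)
qed

lemma pw_affine_has_derivative_outside_mesh:
  assumes "w \<in> pw_affine" and "x \<in> - \<Union>\<T>"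
  shows "(w has_derivative (\<lambda>h. 0 *v h)) (at x)"
proof -
  have "((\<lambda>x. 0 :: real^'n) has_derivative (\<lambda>h. 0 *v h)) (at x)" by simp
  then show ?thesis
    by (rule has_derivative_transform_within_open[OF _ open_mesh_complement assms(2)])
      (use pw_affine_zero_mesh[OF assms(1)] in auto)
qed

lemma pw_gradI:
  assumes "x \<notin> skeleton" and "(w has_derivative (\<lambda>h. A *v h)) (at x)"
  shows "pw_grad w x = A"
  using assms frechet_derivative_at[OF assms(2), symmetric] by (simp add: pw_grad_def matrix_of_matrix_vector_mul)

lemma pw_grad_has_derivative:
  assumes "w \<in> pw_affine" and "x \<notin> skeleton"
  shows "(w has_derivative (\<lambda>h. pw_grad w x *v h)) (at x)"
  using assms(2)
proof (cases rule: skeleton_cases)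
  case (1 K)
  obtain A b where A: "\<And>x. x \<in> K \<Longrightarrow> w x = A *v x + b" using pw_affine_cellE[OF assms(1) 1(1)] by blast
  have "(w has_derivative (\<lambda>h. A *v h)) (at x)"
    by (rule affine_on_cell_has_derivative[OF 1(2) A])
  then show ?thesis using pw_gradI[OF assms(2)] by metis
next
  case 2
  then show ?thesis
    using pw_gradI[OF assms(2)] pw_affine_has_derivative_outside_mesh[OF assms(1)] by metis
qed

lemma pw_grad_add:
  assumes "v \<in> pw_affine" and "w \<in> pw_affine"
  shows "pw_grad (\<lambda>x. v x + w x) x = pw_grad v x + pw_grad w x"
proof (cases "x \<in> skeleton")
  case False
  show ?thesis
    by (rule pw_gradI[OF False])
      (use has_derivative_add[OF pw_grad_has_derivative[OF assms(1) False] pw_grad_has_derivative[OF assms(2) False]]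
       in \<open>simp add: matrix_vector_mult_add_rdistrib\<close>)
qed (simp add: pw_grad_def)

lemma pw_grad_scaleR:
  assumes "w \<in> pw_affine"
  shows "pw_grad (\<lambda>x. c *\<^sub>R w x) x = c *\<^sub>R pw_grad w x"
proof (cases "x \<in> skeleton")
  case False
  show ?thesis
    by (rule pw_gradI[OF False])
      (use has_derivative_scaleR_right[OF pw_grad_has_derivative[OF assms(1) False], of c]
       in \<open>simp add: scaleR_matrix_vector_assoc\<close>)
qed (simp add: pw_grad_def)

lemma pw_grad_locally_constant:
  assumes "w \<in> pw_affine" and "x \<notin> skeleton"
  shows "\<forall>\<^sub>F y in nhds x. pw_grad w y = pw_grad w x"
proof -
  have sk: "\<forall>\<^sub>F y in nhds x. y \<notin> skeleton"
    using closed_skeleton assms(2) by (intro eventually_nhds_in_open[of "- skeleton", simplified]) (auto simp: open_Compl)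
  show ?thesis
    using assms(2)
  proof (cases rule: skeleton_cases)
    case (1 K)
    obtain A b where A: "\<And>x. x \<in> K \<Longrightarrow> w x = A *v x + b" using pw_affine_cellE[OF assms(1) 1(1)] by blast
    have g: "pw_grad w y = A" if "y \<in> interior K" "y \<notin> skeleton" for y
      by (rule pw_gradI[OF that(2) affine_on_cell_has_derivative[OF that(1) A]])
    have "\<forall>\<^sub>F y in nhds x. y \<in> interior K" using 1(2) by (intro eventually_nhds_in_open) auto
    with sk show ?thesis by eventually_elim (simp add: g 1(2) assms(2))
  next
    case 2
    have g: "pw_grad w y = 0" if "y \<in> - \<Union>\<T>" "y \<notin> skeleton" for y
      by (rule pw_gradI[OF that(2) pw_affine_has_derivative_outside_mesh[OF assms(1) that(1)]])
    have "\<forall>\<^sub>F y in nhds x. y \<in> - \<Union>\<T>" using 2 open_mesh_complement by (intro eventually_nhds_in_open) auto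
    with sk show ?thesis by eventually_elim (simp only: g 2 assms(2) not_False_eq_True)
  qed
qed

lemma pw_grad_measurable:
  assumes "w \<in> pw_affine"
  shows "pw_grad w \<in> borel_measurable borel"
proof -
  have "continuous_on (- skeleton) (pw_grad w)"
  proof (rule continuous_at_imp_continuous_on, rule ballI)
    fix x assume "x \<in> - skeleton"
    then have "\<forall>\<^sub>F y in nhds x. pw_grad w y = pw_grad w x"
      using pw_grad_locally_constant[OF assms] by auto
    from isCont_cong[OF this] show "isCont (pw_grad w) x" by simp
  qed
  moreover have "- skeleton \<in> sets borel" using closed_skeleton by (auto intro: borel_open)
  ultimately have "(\<lambda>x. indicator (- skeleton) x *\<^sub>R pw_grad w x) \<in> borel_measurable borel"
    by (intro borel_measurable_continuous_on_indicator)
  moreover have "indicator (- skeleton) x *\<^sub>R pw_grad w x = pw_grad w x" for x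
    by (simp add: pw_grad_def indicator_def)
  ultimately show ?thesis by simp
qed

text \<open>The same matrix describes increments within a cell and the gradient in its interior.\<close>

lemma pw_affine_cell_matrix:
  assumes "w \<in> pw_affine"
  obtains A where "\<And>K x y. K \<in> \<T> \<Longrightarrow> x \<in> K \<Longrightarrow> y \<in> K \<Longrightarrow> w x - w y = A K *v (x - y)"
    and "\<And>K x. K \<in> \<T> \<Longrightarrow> x \<in> interior K \<Longrightarrow> x \<notin> skeleton \<Longrightarrow> pw_grad w x = A K"
proof -
  have "\<forall>K\<in>\<T>. \<exists>A. \<exists>b. \<forall>x\<in>K. w x = A *v x + b" using assms unfolding pw_affine_def by blast
  then obtain A where A: "\<And>K. K \<in> \<T> \<Longrightarrow> \<exists>b. \<forall>x\<in>K. w x = A K *v x + b" by (meson bchoice)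
  show ?thesis
  proof (rule that[of A])
    fix K x y assume *: "K \<in> \<T>" "x \<in> K" "y \<in> K"
    then show "w x - w y = A K *v (x - y)"
      using A[OF *(1)] by (auto simp: matrix_vector_mult_diff_distrib)
  next
    fix K x assume *: "K \<in> \<T>" "x \<in> interior K" "x \<notin> skeleton"
    then show "pw_grad w x = A K"
      using A[OF *(1)] affine_on_cell_has_derivative[OF *(2)] pw_gradI[OF *(3)] by metis
  qed
qed

lemma pw_grad_bounded:
  assumes "w \<in> pw_affine"
  obtains M where "\<And>x. norm (pw_grad w x) \<le> M"
proof -
  obtain A where A: "\<And>K x. K \<in> \<T> \<Longrightarrow> x \<in> interior K \<Longrightarrow> x \<notin> skeleton \<Longrightarrow> pw_grad w x = A K"
    using pw_affine_cell_matrix[OF assms] by metis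
  have "norm (pw_grad w x) \<le> (\<Sum>K\<in>\<T>. norm (A K))" for x
  proof (cases "x \<in> skeleton")
    case True
    then show ?thesis by (simp add: pw_grad_def sum_nonneg)
  next
    case False
    then show ?thesis
    proof (cases rule: skeleton_cases)
      case (1 K)
      then show ?thesis
        using A[OF 1 False] finite_mesh member_le_sum[of K \<T> "\<lambda>K. norm (A K)"] by simp
    next
      case 2
      then show ?thesis
        using pw_gradI[OF False pw_affine_has_derivative_outside_mesh[OF assms 2]] by (simp add: sum_nonneg)
    qed
  qed
  then show ?thesis using that by blast
qed

lemma closed_line_cell:
  assumes "K \<in> \<T>" shows "closed {t::real. x + t *\<^sub>R d \<in> K}"
  using continuous_closed_vimage[of K "\<lambda>t. x + t *\<^sub>R d"] compact_imp_closed[OF compact_cell[OF assms]]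
  by (auto simp: vimage_def intro!: continuous_intros)

text \<open>A line is covered by the closed sets where it meets a given cell, together with the closed set
  where the field vanishes; on each of them the field is Lipschitz.\<close>

lemma pw_affine_Lipschitz:
  assumes "w \<in> pw_affine"
  obtains L where "\<And>x d t. norm (w (x + t *\<^sub>R d) - w x) \<le> L * norm d * \<bar>t\<bar>"
proof -
  obtain A where A: "\<And>K x y. K \<in> \<T> \<Longrightarrow> x \<in> K \<Longrightarrow> y \<in> K \<Longrightarrow> w x - w y = A K *v (x - y)"
    using pw_affine_cell_matrix[OF assms] by metis
  define L where "L = (\<Sum>K\<in>\<T>. onorm ((*v) (A K)))"
  have L0: "L \<ge> 0" unfolding L_def by (intro sum_nonneg onorm_pos_le matrix_vector_mul_bounded_linear)
  have LK: "norm (w x - w y) \<le> L * norm (x - y)" if "K \<in> \<T>" "x \<in> K" "y \<in> K" for K x y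
  proof -
    have "norm (w x - w y) \<le> onorm ((*v) (A K)) * norm (x - y)"
      unfolding A[OF that] by (rule onorm[OF matrix_vector_mul_bounded_linear])
    also have "\<dots> \<le> L * norm (x - y)"
      unfolding L_def using that(1) finite_mesh
      by (intro mult_right_mono member_le_sum) (auto intro!: onorm_pos_le matrix_vector_mul_bounded_linear)
    finally show ?thesis .
  qed
  have line: "lipschitz_on (L * norm d) {0..s} (\<lambda>t. w (x + t *\<^sub>R d))" for x d s
  proof (rule lipschitz_on_closed_Union[where I = "insert {t. w (x + t *\<^sub>R d) = 0} ((\<lambda>K. {t. x + t *\<^sub>R d \<in> K}) ` \<T>)" and U = id])
    fix U assume "U \<in> insert {t. w (x + t *\<^sub>R d) = 0} ((\<lambda>K. {t. x + t *\<^sub>R d \<in> K}) ` \<T>)"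
    then consider "U = {t. w (x + t *\<^sub>R d) = 0}" | K where "K \<in> \<T>" "U = {t. x + t *\<^sub>R d \<in> K}" by blast
    note cs = this
    from cs show "lipschitz_on (L * norm d) (id U) (\<lambda>t. w (x + t *\<^sub>R d))"
    proof cases
      case 1
      then show ?thesis using L0 by (auto intro!: lipschitz_onI)
    next
      case 2
      show ?thesis
      proof (rule lipschitz_onI)
        fix s t assume "s \<in> id U" "t \<in> id U"
        then have "norm (w (x + s *\<^sub>R d) - w (x + t *\<^sub>R d)) \<le> L * norm ((x + s *\<^sub>R d) - (x + t *\<^sub>R d))"
          using 2 by (intro LK[OF 2(1)]) auto
        also have "(x + s *\<^sub>R d) - (x + t *\<^sub>R d) = (s - t) *\<^sub>R d" by (simp add: algebra_simps)
        finally show "dist (w (x + s *\<^sub>R d)) (w (x + t *\<^sub>R d)) \<le> L * norm d * dist s t"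
          by (simp add: dist_norm mult_ac)
      qed (use L0 in simp)
    qed
    from cs show "closed (id U)"
    proof cases
      case 1
      have "continuous_on UNIV (\<lambda>t. w (x + t *\<^sub>R d))"
        by (intro continuous_on_compose2[OF pw_affine_continuous[OF assms]] continuous_intros) auto
      then show ?thesis using 1 by (auto intro!: closed_Collect_eq)
    qed (simp add: closed_line_cell)
  qed (use finite_mesh L0 pw_affine_zero_mesh[OF assms] in \<open>auto simp del: Union_iff\<close>)
  have "norm (w (x + t *\<^sub>R d) - w x) \<le> L * norm d * \<bar>t\<bar>" if "t \<ge> 0" for x d t
    using lipschitz_onD[OF line[of d t x], of t 0] that by (simp add: dist_norm)
  note pos = this
  have "norm (w (x + t *\<^sub>R d) - w x) \<le> L * norm d * \<bar>t\<bar>" for x d t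
    using pos[of t x d] pos[of "- t" "x" "- d"] by (cases "t \<ge> 0") auto
  then show ?thesis using that by blast
qed

lemma pw_affine_bounded:
  assumes "w \<in> pw_affine"
  obtains U where "\<And>x. norm (w x) \<le> U"
proof -
  have "compact (closure \<Omega>)" using bounded_domain by simp
  then have "bounded (w ` closure \<Omega>)"
    using pw_affine_continuous[OF assms] by (intro compact_imp_bounded compact_continuous_image) (auto intro: continuous_on_subset)
  then obtain U where U: "\<And>x. x \<in> closure \<Omega> \<Longrightarrow> norm (w x) \<le> U" unfolding bounded_iff by auto
  have "norm (w x) \<le> max U 0" for x
  proof (cases "x \<in> \<Omega>")
    case True
    then have "x \<in> closure \<Omega>" using closure_subset by blast
    then show ?thesis using U[of x] by simp
  qed (simp add: pw_affine_zero[OF assms])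
  then show ?thesis using that by blast
qed

lemma domain_lmeasurable: "\<Omega> \<in> lmeasurable"
  using open_domain bounded_domain by (simp add: lmeasurable_open)

lemma L2_field_bounded:
  fixes u :: "real^'n \<Rightarrow> 'b::euclidean_space"
  assumes "u \<in> borel_measurable borel" and "\<And>x. norm (u x) \<le> U"
  shows "L2_field \<Omega> u"
proof -
  interpret finite_measure "lebesgue_on \<Omega>" using domain_lmeasurable by (rule finite_measure_lebesgue_on)
  have "integrable (lebesgue_on \<Omega>) (\<lambda>x. (norm (u x))\<^sup>2)"
    by (rule integrable_const_bound[where B = "U\<^sup>2"])
      (use assms(2) lebesgue_on_measurable[OF assms(1)] in \<open>auto intro!: AE_I2 power_mono\<close>)
  then show ?thesis using lebesgue_on_measurable[OF assms(1)] by (simp add: L2_field_def)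
qed

lemma pw_affine_has_weak_gradient:
  assumes "w \<in> pw_affine"
  shows "has_weak_gradient \<Omega> w (pw_grad w)"
proof -
  obtain M where M: "\<And>x. norm (pw_grad w x) \<le> M" using pw_grad_bounded[OF assms] by blast
  obtain U where U: "\<And>x. norm (w x) \<le> U" using pw_affine_bounded[OF assms] by blast
  obtain L where L: "\<And>x d t. norm (w (x + t *\<^sub>R d) - w x) \<le> L * norm d * \<bar>t\<bar>"
    using pw_affine_Lipschitz[OF assms] by blast
  note m = pw_grad_measurable[OF assms]
  have "(LINT x|lebesgue_on \<Omega>. w x $ i * partial \<phi> j x) = - (LINT x|lebesgue_on \<Omega>. pw_grad w x $ i $ j * \<phi> x)"
    if \<phi>: "test_function \<Omega> \<phi>" for \<phi> i j
  proof (rule integration_by_parts_Lipschitz[where L = "max L M", OF bounded_domain _ _ _ _ _ _ _ \<phi>])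
    show "continuous_on UNIV (\<lambda>x. w x $ i)"
      by (intro continuous_on_component pw_affine_continuous assms)
    show "w x $ i = 0" if "x \<notin> \<Omega>" for x using pw_affine_zero[OF assms that] by simp
    show "\<bar>w (x + t *\<^sub>R axis j 1) $ i - w x $ i\<bar> \<le> max L M * \<bar>t\<bar>" for x t
    proof -
      have "\<bar>w (x + t *\<^sub>R axis j 1) $ i - w x $ i\<bar> \<le> norm (w (x + t *\<^sub>R axis j 1) - w x)"
        using component_le_norm_cart[of "w (x + t *\<^sub>R axis j 1) - w x" i] by simp
      also have "\<dots> \<le> L * \<bar>t\<bar>" using L[of x t "axis j 1"] by simp
      also have "\<dots> \<le> max L M * \<bar>t\<bar>" by (intro mult_right_mono) auto
      finally show ?thesis .
    qed
    show "(\<lambda>x. pw_grad w x $ i $ j) \<in> borel_measurable lebesgue"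
    proof -
      have "(\<lambda>G :: real^'n^'n. G $ i $ j) \<in> borel_measurable borel"
        by (intro borel_measurable_continuous_onI continuous_intros)
      from measurable_compose[OF m this] show ?thesis by (intro measurable_completion) simp
    qed
    show "\<bar>pw_grad w x $ i $ j\<bar> \<le> max L M" for x
      using component_le_norm_cart[of "pw_grad w x $ i" j] Finite_Cartesian_Product.norm_nth_le[of "pw_grad w x" i] M[of x]
      by (simp add: le_max_iff_disj)
    show "AE x in lebesgue. ((\<lambda>t. w (x + t *\<^sub>R axis j 1) $ i) has_real_derivative pw_grad w x $ i $ j) (at 0)"
      using AE_not_skeleton
    proof eventually_elim
      case (elim x)
      have "(w has_derivative (\<lambda>h. pw_grad w x *v h)) (at (x + 0 *\<^sub>R axis j 1))"
        using pw_grad_has_derivative[OF assms elim] by simp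
      then have "((\<lambda>t. w (x + t *\<^sub>R axis j 1)) has_derivative (\<lambda>t. pw_grad w x *v (t *\<^sub>R axis j 1))) (at 0)"
        by (rule has_derivative_compose[rotated]) (auto intro!: derivative_eq_intros)
      then have "((\<lambda>t. w (x + t *\<^sub>R axis j 1) $ i) has_derivative (\<lambda>t. (pw_grad w x *v (t *\<^sub>R axis j 1)) $ i)) (at 0)"
        by (rule bounded_linear.has_derivative[OF bounded_linear_vec_nth])
      moreover have "(\<lambda>t. (pw_grad w x *v (t *\<^sub>R axis j 1)) $ i) = (*) (pw_grad w x $ i $ j)"
        by (auto simp: matrix_vector_mult_scaleR matrix_vector_mult_basis column_def)
      ultimately show ?case by (simp add: has_field_derivative_def)
    qed
    show "\<Omega> \<in> sets lebesgue" using domain_lmeasurable by auto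
  qed
  then show ?thesis
    unfolding has_weak_gradient_def
    using L2_field_bounded[OF m M] L2_field_bounded[OF borel_measurable_continuous_onI[OF pw_affine_continuous[OF assms]] U]
    by blast
qed

end

section \<open>The elastic form on piecewise affine fields\<close>

text \<open>The symmetric part of a displacement gradient, that is, the strain.\<close>

definition sym_part :: "real^'n^'n \<Rightarrow> real^'n^'n" where
  "sym_part G = (1/2) *\<^sub>R (G + transpose G)"

text \<open>The integrand of the elastic form as a symmetric bilinear form in two displacement gradients.\<close>

definition elastic_density :: "real \<Rightarrow> real \<Rightarrow> real^'n^'n \<Rightarrow> real^'n^'n \<Rightarrow> real" where
  "elastic_density E \<nu> G H = E / (1 + \<nu>) *
     (sym_part G \<bullet> sym_part H + \<nu> / (1 - 2 * \<nu>) * (trace (sym_part G) * trace (sym_part H)))"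

lemma mat_1_inner: "(mat 1 :: real^'n^'n) \<bullet> H = trace H"
  by (simp add: inner_vec_def mat_def trace_def if_distrib if_distribR cong: if_cong)

lemma transpose_add: "transpose (A + B :: real^'n^'n) = transpose A + transpose B"
  and transpose_scaleR: "transpose (c *\<^sub>R A :: real^'n^'n) = c *\<^sub>R transpose A"
  by (simp_all add: transpose_def vec_eq_iff)

lemma sym_part_add: "sym_part (G + H) = sym_part G + sym_part H"
  and sym_part_scaleR: "sym_part (c *\<^sub>R G) = c *\<^sub>R sym_part G"
  by (simp_all add: sym_part_def transpose_add transpose_scaleR algebra_simps)

lemma trace_scaleR: "trace (c *\<^sub>R A :: real^'n^'n) = c * trace A"
  by (simp add: trace_def sum_distrib_left)

lemma elastic_density_add: "elastic_density E \<nu> (G + G') H = elastic_density E \<nu> G H + elastic_density E \<nu> G' H"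
  by (simp add: elastic_density_def sym_part_add trace_add inner_add_left algebra_simps)

lemma elastic_density_scaleR: "elastic_density E \<nu> (c *\<^sub>R G) H = c * elastic_density E \<nu> G H"
  by (simp add: elastic_density_def sym_part_scaleR trace_scaleR algebra_simps)

lemma elastic_density_commute: "elastic_density E \<nu> G H = elastic_density E \<nu> H G"
  by (simp add: elastic_density_def inner_commute mult.commute)

lemma elastic_density_ge:
  assumes "E > 0" and "0 \<le> \<nu>" and "\<nu> < 1/2"
  shows "E / (1 + \<nu>) * (norm (sym_part G))\<^sup>2 \<le> elastic_density E \<nu> G G"
  unfolding elastic_density_def using assms
  by (intro mult_left_mono) (auto simp: power2_norm_eq_inner)

lemma continuous_elastic_density:
  "continuous_on UNIV (\<lambda>p :: (real^'n^'n) \<times> (real^'n^'n). elastic_density E \<nu> (fst p) (snd p))"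
proof -
  have s: "continuous_on UNIV (\<lambda>p. sym_part (f p))"
    if "continuous_on UNIV f" for f :: "(real^'n^'n) \<times> (real^'n^'n) \<Rightarrow> real^'n^'n"
    unfolding sym_part_def transpose_def using that by (intro continuous_intros) auto
  have t: "continuous_on UNIV (\<lambda>p. trace (f p))"
    if "continuous_on UNIV f" for f :: "(real^'n^'n) \<times> (real^'n^'n) \<Rightarrow> real^'n^'n"
    unfolding trace_def using that by (intro continuous_intros)
  show ?thesis
    unfolding elastic_density_def by (intro continuous_intros s t)
qed

lemma elastic_form_eq_density:
  "elastic_form E \<nu> \<Omega> u v = (LINT x|lebesgue_on \<Omega>. elastic_density E \<nu> (weak_grad \<Omega> u x) (weak_grad \<Omega> v x))"
  unfolding elastic_form_def
proof (rule arg_cong[where f = "integral\<^sup>L (lebesgue_on \<Omega>)"], rule ext)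
  fix x
  have "strain \<Omega> w x = sym_part (weak_grad \<Omega> w x)" for w
    by (simp add: strain_def sym_part_def)
  then show "stress E \<nu> \<Omega> u x \<bullet> strain \<Omega> v x = elastic_density E \<nu> (weak_grad \<Omega> u x) (weak_grad \<Omega> v x)"
    by (simp add: stress_def elastic_density_def inner_add_left mat_1_inner)
qed

context affine_mesh
begin

lemma weak_grad_pw_affine:
  assumes "w \<in> pw_affine"
  shows "AE x in lebesgue_on \<Omega>. weak_grad \<Omega> w x = pw_grad w x"
  by (rule weak_grad_AE_eq[OF open_domain bounded_domain pw_affine_has_weak_gradient[OF assms]])

lemma weak_grad_pw_affine_measurable:
  assumes "w \<in> pw_affine"
  shows "weak_grad \<Omega> w \<in> borel_measurable (lebesgue_on \<Omega>)"
proof -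
  have "has_weak_gradient \<Omega> w (weak_grad \<Omega> w)"
    unfolding weak_grad_def by (rule someI[of "has_weak_gradient \<Omega> w", OF pw_affine_has_weak_gradient[OF assms]])
  then show ?thesis by (simp add: has_weak_gradient_def L2_field_def)
qed

lemma elastic_density_integrable:
  assumes "v \<in> pw_affine" and "w \<in> pw_affine"
  shows "integrable (lebesgue_on \<Omega>) (\<lambda>x. elastic_density E \<nu> (pw_grad v x) (pw_grad w x))"
proof -
  interpret finite_measure "lebesgue_on \<Omega>" using domain_lmeasurable by (rule finite_measure_lebesgue_on)
  obtain M where M: "\<And>x. norm (pw_grad v x) \<le> M" using pw_grad_bounded[OF assms(1)] by blast
  obtain M' where M': "\<And>x. norm (pw_grad w x) \<le> M'" using pw_grad_bounded[OF assms(2)] by blast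
  have "compact (cball 0 M \<times> cball 0 M' :: ((real^'n^'n) \<times> (real^'n^'n)) set)"
    by (intro compact_Times compact_cball)
  then have "bounded ((\<lambda>p. elastic_density E \<nu> (fst p) (snd p)) ` (cball 0 M \<times> cball 0 M' :: ((real^'n^'n) \<times> (real^'n^'n)) set))"
    by (intro compact_imp_bounded compact_continuous_image continuous_on_subset[OF continuous_elastic_density]) auto
  then obtain C where C: "\<forall>y \<in> (\<lambda>p. elastic_density E \<nu> (fst p) (snd p)) ` (cball 0 M \<times> cball 0 M' :: ((real^'n^'n) \<times> (real^'n^'n)) set). norm y \<le> C"
    unfolding bounded_iff by blast
  have "\<bar>elastic_density E \<nu> (pw_grad v x) (pw_grad w x)\<bar> \<le> C" for x
    using bspec[OF C imageI, of "(pw_grad v x, pw_grad w x)"] M[of x] M'[of x] by simp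
  moreover have "(\<lambda>x. elastic_density E \<nu> (pw_grad v x) (pw_grad w x)) \<in> borel_measurable (lebesgue_on \<Omega>)"
    using pw_grad_measurable assms
    by (intro lebesgue_on_measurable borel_measurable_continuous_Pair[OF _ _ continuous_elastic_density]) auto
  ultimately show ?thesis
    by (intro integrable_const_bound[where B = C] AE_I2) auto
qed

lemma elastic_form_pw_affine:
  assumes "v \<in> pw_affine" and "w \<in> pw_affine"
  shows "elastic_form E \<nu> \<Omega> v w = (LINT x|lebesgue_on \<Omega>. elastic_density E \<nu> (pw_grad v x) (pw_grad w x))"
  unfolding elastic_form_eq_density
proof (rule integral_cong_AE)
  show "(\<lambda>x. elastic_density E \<nu> (weak_grad \<Omega> v x) (weak_grad \<Omega> w x)) \<in> borel_measurable (lebesgue_on \<Omega>)"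
    by (intro borel_measurable_continuous_Pair[OF _ _ continuous_elastic_density] weak_grad_pw_affine_measurable assms)
  show "AE x in lebesgue_on \<Omega>. elastic_density E \<nu> (weak_grad \<Omega> v x) (weak_grad \<Omega> w x) =
      elastic_density E \<nu> (pw_grad v x) (pw_grad w x)"
    using weak_grad_pw_affine[OF assms(1)] weak_grad_pw_affine[OF assms(2)] by eventually_elim simp
qed (use elastic_density_integrable[OF assms] in auto)

lemma elastic_form_add:
  assumes "u \<in> pw_affine" and "v \<in> pw_affine" and "w \<in> pw_affine"
  shows "elastic_form E \<nu> \<Omega> (\<lambda>x. u x + v x) w = elastic_form E \<nu> \<Omega> u w + elastic_form E \<nu> \<Omega> v w"
  using assms by (simp add: elastic_form_pw_affine add_pw_affine pw_grad_add elastic_density_add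
      Bochner_Integration.integral_add elastic_density_integrable)

lemma elastic_form_scaleR:
  assumes "v \<in> pw_affine" and "w \<in> pw_affine"
  shows "elastic_form E \<nu> \<Omega> (\<lambda>x. c *\<^sub>R v x) w = c * elastic_form E \<nu> \<Omega> v w"
  using assms by (simp add: elastic_form_pw_affine scaleR_pw_affine pw_grad_scaleR elastic_density_scaleR)

lemma elastic_form_commute:
  assumes "v \<in> pw_affine" and "w \<in> pw_affine"
  shows "elastic_form E \<nu> \<Omega> v w = elastic_form E \<nu> \<Omega> w v"
  using assms by (simp add: elastic_form_pw_affine elastic_density_commute)

text \<open>This replaces Korn's inequality. If the strain vanishes, the gradient is skew on each cell, so for
  every direction \<open>d\<close> the function \<open>t \<mapsto> d \<bullet> w (x + t *\<^sub>R d)\<close> is constant on the part of the line in each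
  cell. It therefore takes finitely many values, and being continuous it is constant. It vanishes far
  out, hence everywhere.\<close>

lemma pw_affine_zero_strain_imp_zero:
  assumes "w \<in> pw_affine" and "AE x in lebesgue_on \<Omega>. sym_part (pw_grad w x) = 0"
  shows "w = (\<lambda>x. 0)"
proof -
  obtain A where A: "\<And>K x y. K \<in> \<T> \<Longrightarrow> x \<in> K \<Longrightarrow> y \<in> K \<Longrightarrow> w x - w y = A K *v (x - y)"
    and G: "\<And>K x. K \<in> \<T> \<Longrightarrow> x \<in> interior K \<Longrightarrow> x \<notin> skeleton \<Longrightarrow> pw_grad w x = A K"
    using pw_affine_cell_matrix[OF assms(1)] by metis
  have skew: "d \<bullet> (A K *v d) = 0" if K: "K \<in> \<T>" for K d
  proof -
    let ?U = "interior K \<inter> \<Omega>"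
    have "interior K \<subseteq> closure \<Omega>" using K mesh_subset interior_subset by blast
    then have ne: "?U \<noteq> {}"
      using interior_cell[OF K] open_Int_closure_eq_empty[OF open_interior, of K \<Omega>] by blast
    have "\<exists>x\<in>?U. x \<notin> skeleton \<and> sym_part (pw_grad w x) = 0"
    proof (rule ccontr)
      assume c: "\<not> ?thesis"
      have "AE x in lebesgue. x \<in> \<Omega> \<longrightarrow> sym_part (pw_grad w x) = 0"
        using assms(2) domain_lmeasurable by (simp add: AE_restrict_space_iff)
      then have "AE x in lebesgue. x \<notin> ?U"
        using AE_not_skeleton by eventually_elim (use c in blast)
      moreover have "open ?U" using open_domain by blast
      ultimately have "?U \<in> null_sets lebesgue"
        by (subst (asm) AE_iff_null_sets[symmetric]) auto
      then show False
        using open_not_negligible[OF \<open>open ?U\<close> ne] by (simp add: negligible_iff_null_sets)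
    qed
    then obtain x where "x \<in> ?U" "x \<notin> skeleton" "sym_part (pw_grad w x) = 0" by blast
    then have "sym_part (A K) = 0" using G[OF K] by auto
    then have "A K + transpose (A K) = 0" by (simp add: sym_part_def)
    then have "d \<bullet> ((A K + transpose (A K)) *v d) = 0" by simp
    then have "d \<bullet> (A K *v d) + d \<bullet> (transpose (A K) *v d) = 0"
      by (simp add: matrix_vector_mult_add_rdistrib inner_add_right)
    moreover have "d \<bullet> (transpose (A K) *v d) = d \<bullet> (A K *v d)"
      by (simp add: transpose_matrix_vector inner_commute[of d "d v* A K"] dot_lmul_matrix)
    ultimately show ?thesis by simp
  qed
  have along: "d \<bullet> w x = 0" for x d
  proof (cases "d = 0")
    case False
    define f where "f t = d \<bullet> w (x + t *\<^sub>R d)" for t :: real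
    have cf: "continuous_on UNIV f" unfolding f_def
      by (intro continuous_intros continuous_on_compose2[OF pw_affine_continuous[OF assms(1)]]) auto
    have const: "f s = f t" if "K \<in> \<T>" "x + s *\<^sub>R d \<in> K" "x + t *\<^sub>R d \<in> K" for K s t
    proof -
      have "f s - f t = d \<bullet> (w (x + s *\<^sub>R d) - w (x + t *\<^sub>R d))" by (simp add: f_def inner_diff_right)
      also have "\<dots> = d \<bullet> (A K *v ((s - t) *\<^sub>R d))"
        unfolding A[OF that] by (simp add: algebra_simps)
      also have "\<dots> = 0" using skew[OF that(1)] by (simp add: matrix_vector_mult_scaleR)
      finally show ?thesis by simp
    qed
    have "range f \<subseteq> insert 0 ((\<lambda>K. f (SOME t. x + t *\<^sub>R d \<in> K)) ` \<T>)"
    proof (rule image_subsetI)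
      fix t
      show "f t \<in> insert 0 ((\<lambda>K. f (SOME t. x + t *\<^sub>R d \<in> K)) ` \<T>)"
      proof (cases "x + t *\<^sub>R d \<in> \<Union>\<T>")
        case True
        then obtain K where K: "K \<in> \<T>" "x + t *\<^sub>R d \<in> K" by blast
        have "f t = f (SOME t. x + t *\<^sub>R d \<in> K)"
          using const[OF K(1) K(2) someI[of "\<lambda>t. x + t *\<^sub>R d \<in> K", OF K(2)]] .
        then show ?thesis using K(1) by blast
      next
        case False
        then show ?thesis using pw_affine_zero_mesh[OF assms(1) False] by (simp add: f_def)
      qed
    qed
    then have "finite (range f)" using finite_mesh by (meson finite_imageI finite_insert finite_subset)
    from continuous_finite_range_constant[OF connected_UNIV cf this]
    have fc: "f s = f t" for s t by (auto simp: constant_on_def)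
    obtain R where R: "R > 0" "\<And>x. x \<in> \<Omega> \<Longrightarrow> norm x \<le> R" using bounded_domain bounded_pos by blast
    define s where "s = (R + norm x + 1) / norm d"
    have "norm (s *\<^sub>R d) = R + norm x + 1" using False R(1) by (simp add: s_def)
    moreover have "norm (s *\<^sub>R d) \<le> norm (x + s *\<^sub>R d) + norm x"
      using norm_triangle_ineq4[of "x + s *\<^sub>R d" x] by simp
    ultimately have "x + s *\<^sub>R d \<notin> \<Omega>" using R(2)[of "x + s *\<^sub>R d"] by linarith
    then have "f s = 0" using pw_affine_zero[OF assms(1)] by (simp add: f_def)
    then show ?thesis using fc[of 0 s] by (simp add: f_def)
  qed simp
  show ?thesis using along[of "w x" x for x] by (auto simp: fun_eq_iff)
qed

lemma elastic_form_pos: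
  assumes "E > 0" and "0 \<le> \<nu>" and "\<nu> < 1/2" and "w \<in> pw_affine" and "w \<noteq> (\<lambda>x. 0)"
  shows "elastic_form E \<nu> \<Omega> w w > 0"
proof -
  let ?d = "\<lambda>x. elastic_density E \<nu> (pw_grad w x) (pw_grad w x)"
  have ge: "E / (1 + \<nu>) * (norm (sym_part (pw_grad w x)))\<^sup>2 \<le> ?d x" for x
    by (rule elastic_density_ge[OF assms(1-3)])
  have c: "E / (1 + \<nu>) > 0" using assms(1,2) by simp
  have d0: "0 \<le> ?d x" for x
    using ge[of x] c by (meson mult_nonneg_nonneg order_less_imp_le order_trans zero_le_power2)
  note int = elastic_density_integrable[OF assms(4) assms(4), of E \<nu>]
  have "(LINT x|lebesgue_on \<Omega>. ?d x) \<noteq> 0"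
  proof
    assume "(LINT x|lebesgue_on \<Omega>. ?d x) = 0"
    then have "AE x in lebesgue_on \<Omega>. ?d x = 0"
      using integral_nonneg_eq_0_iff_AE[OF int] d0 by simp
    then have "AE x in lebesgue_on \<Omega>. sym_part (pw_grad w x) = 0"
    proof eventually_elim
      case (elim x)
      then have "E / (1 + \<nu>) * (norm (sym_part (pw_grad w x)))\<^sup>2 \<le> 0" using ge[of x] by simp
      then have "(norm (sym_part (pw_grad w x)))\<^sup>2 \<le> 0"
        using c by (simp only: mult_le_0_iff) linarith
      then show ?case by simp
    qed
    then show False using pw_affine_zero_strain_imp_zero[OF assms(4)] assms(5) by blast
  qed
  moreover have "(LINT x|lebesgue_on \<Omega>. ?d x) \<ge> 0" using d0 by (intro Bochner_Integration.integral_nonneg) auto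
  ultimately show ?thesis by (simp add: elastic_form_pw_affine[OF assms(4,4)])
qed

lemma H1_norm_le:
  assumes "w \<in> pw_affine" and S: "\<And>x. norm (w x) \<le> S" and M: "\<And>x. norm (pw_grad w x) \<le> M"
  shows "H1_norm \<Omega> w \<le> sqrt (measure lebesgue \<Omega>) * (S + M)"
proof -
  interpret finite_measure "lebesgue_on \<Omega>" using domain_lmeasurable by (rule finite_measure_lebesgue_on)
  have SM: "S \<ge> 0" "M \<ge> 0" using S[of 0] M[of 0] norm_ge_zero order_trans by blast+
  have meas: "measure (lebesgue_on \<Omega>) \<Omega> = measure lebesgue \<Omega>"
    using domain_lmeasurable by (simp add: measure_restrict_space)
  have const: "(LINT x|lebesgue_on \<Omega>. c) = measure lebesgue \<Omega> * c" for c :: real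
    using meas by simp
  have 1: "(LINT x|lebesgue_on \<Omega>. (norm (w x))\<^sup>2) \<le> measure lebesgue \<Omega> * S\<^sup>2"
    unfolding const[symmetric] using S by (intro integral_mono') (auto intro!: power_mono)
  have "(LINT x|lebesgue_on \<Omega>. (norm (weak_grad \<Omega> w x))\<^sup>2) = (LINT x|lebesgue_on \<Omega>. (norm (pw_grad w x))\<^sup>2)"
  proof (rule integral_cong_AE)
    show "AE x in lebesgue_on \<Omega>. (norm (weak_grad \<Omega> w x))\<^sup>2 = (norm (pw_grad w x))\<^sup>2"
      using weak_grad_pw_affine[OF assms(1)] by eventually_elim simp
  qed (use weak_grad_pw_affine_measurable[OF assms(1)] lebesgue_on_measurable[OF pw_grad_measurable[OF assms(1)]] in auto)
  also have "\<dots> \<le> measure lebesgue \<Omega> * M\<^sup>2"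
    unfolding const[symmetric] using M by (intro integral_mono') (auto intro!: power_mono)
  finally have "H1_norm \<Omega> w \<le> sqrt (measure lebesgue \<Omega> * S\<^sup>2 + measure lebesgue \<Omega> * M\<^sup>2)"
    unfolding H1_norm_def using 1 by (intro real_sqrt_le_mono add_mono)
  also have "\<dots> \<le> sqrt (measure lebesgue \<Omega> * (S + M)\<^sup>2)"
    using SM by (intro real_sqrt_le_mono) (simp add: power2_sum algebra_simps)
  also have "\<dots> = sqrt (measure lebesgue \<Omega>) * (S + M)"
    using SM by (simp add: real_sqrt_mult)
  finally show ?thesis .
qed

end

section \<open>Expansion with respect to an inner product on a finite-dimensional span\<close>

text \<open>Gram--Schmidt for a bilinear form that is an inner product on a subspace: the span of a finite set
  has a finite family \<open>E\<close> with respect to which each vector has the usual Fourier expansion. This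
  property of \<open>E\<close> is strong enough for the induction, so orthonormality is not recorded separately.\<close>

lemma inner_product_expansion:
  fixes a :: "'v::real_vector \<Rightarrow> 'v \<Rightarrow> real"
  assumes "finite B" and V: "subspace V" and "B \<subseteq> V"
    and add: "\<And>u v w. u \<in> V \<Longrightarrow> v \<in> V \<Longrightarrow> w \<in> V \<Longrightarrow> a (u + v) w = a u w + a v w"
    and scale: "\<And>r u v. u \<in> V \<Longrightarrow> v \<in> V \<Longrightarrow> a (r *\<^sub>R u) v = r * a u v"
    and sym: "\<And>u v. u \<in> V \<Longrightarrow> v \<in> V \<Longrightarrow> a u v = a v u"
    and pos: "\<And>u. u \<in> V \<Longrightarrow> u \<noteq> 0 \<Longrightarrow> a u u > 0"
  obtains E where "finite E" "E \<subseteq> span B" "\<And>v. v \<in> span B \<Longrightarrow> v = (\<Sum>e\<in>E. a v e *\<^sub>R e)"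
proof -
  have sum: "a (\<Sum>e\<in>E. c e *\<^sub>R e) w = (\<Sum>e\<in>E. c e * a e w)"
    if "finite E" "E \<subseteq> V" "w \<in> V" for E c w
    using that
  proof (induction E rule: finite_induct)
    case empty
    have "a (0 *\<^sub>R w) w = 0 * a w w" using scale[OF that(3) that(3)] .
    then show ?case by simp
  next
    case (insert e E)
    have "(\<Sum>e\<in>E. c e *\<^sub>R e) \<in> V"
      using insert.prems V by (auto intro!: subspace_sum subspace_scale)
    then show ?case using insert V by (simp add: add scale subspace_scale)
  qed
  have "\<exists>E. finite E \<and> E \<subseteq> span B \<and> (\<forall>v\<in>span B. v = (\<Sum>e\<in>E. a v e *\<^sub>R e))"
    using \<open>finite B\<close> \<open>B \<subseteq> V\<close>
  proof (induction B rule: finite_induct)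
    case empty
    show ?case by (rule exI[of _ "{}"]) simp
  next
    case (insert \<beta> B)
    then obtain E where E: "finite E" "E \<subseteq> span B" "\<And>v. v \<in> span B \<Longrightarrow> v = (\<Sum>e\<in>E. a v e *\<^sub>R e)"
      by auto
    have BV: "span B \<subseteq> V" using insert.prems V by (intro span_minimal) auto
    then have EV: "E \<subseteq> V" using E(2) by blast
    have \<beta>V: "\<beta> \<in> V" using insert.prems by simp
    define p where "p = (\<Sum>e\<in>E. a \<beta> e *\<^sub>R e)"
    \<comment> \<open>\<open>\<gamma>\<close> is the component of the new vector orthogonal to the span of the old ones.\<close>
    define \<gamma> where "\<gamma> = \<beta> - p"
    have p: "p \<in> span B" unfolding p_def using E(2) by (auto intro!: span_sum span_scale)
    have \<gamma>V: "\<gamma> \<in> V" unfolding \<gamma>_def using \<beta>V p BV V by (auto intro: subspace_diff)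
    have orth: "a \<gamma> z = 0" if z: "z \<in> span B" for z
    proof -
      have zV: "z \<in> V" using z BV by blast
      have "a \<beta> z = a z \<beta>" using sym \<beta>V zV by blast
      also have "\<dots> = a (\<Sum>e\<in>E. a z e *\<^sub>R e) \<beta>" using E(3)[OF z] by simp
      also have "\<dots> = (\<Sum>e\<in>E. a z e * a e \<beta>)" using sum[OF E(1) EV \<beta>V] .
      also have "\<dots> = (\<Sum>e\<in>E. a \<beta> e * a e z)"
        using EV zV \<beta>V sym by (intro sum.cong refl) (metis mult.commute subsetD)
      also have "\<dots> = a p z" unfolding p_def using sum[OF E(1) EV zV] by simp
      finally have "a \<beta> z = a p z" .
      moreover have "a \<beta> z = a (p + \<gamma>) z" by (simp add: \<gamma>_def)
      ultimately show ?thesis using add[of p \<gamma> z] p BV \<gamma>V zV by auto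
    qed
    have decomp: "\<exists>z c. z \<in> span B \<and> v = z + c *\<^sub>R \<gamma>" if v: "v \<in> span (insert \<beta> B)" for v
    proof -
      obtain c where c: "v - c *\<^sub>R \<beta> \<in> span B" using v by (auto simp: span_insert)
      have "(v - c *\<^sub>R \<beta>) + c *\<^sub>R p \<in> span B" using c p by (intro span_add span_scale)
      moreover have "v = ((v - c *\<^sub>R \<beta>) + c *\<^sub>R p) + c *\<^sub>R \<gamma>" by (simp add: \<gamma>_def algebra_simps)
      ultimately show ?thesis by blast
    qed
    show ?case
    proof (cases "\<gamma> = 0")
      case True
      then have "span (insert \<beta> B) \<subseteq> span B" using decomp by fastforce
      then show ?thesis using E span_mono[of B "insert \<beta> B"] by (intro exI[of _ E]) blast
    next
      case False
      define s where "s = sqrt (a \<gamma> \<gamma>)"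
      have s: "s > 0" "s * s = a \<gamma> \<gamma>" using pos[OF \<gamma>V False] by (auto simp: s_def)
      define e0 where "e0 = (1 / s) *\<^sub>R \<gamma>"
      have e0V: "e0 \<in> V" unfolding e0_def using \<gamma>V V by (auto intro: subspace_scale)
      have e0: "a u e0 = a u \<gamma> / s" if "u \<in> V" for u
        using sym[OF that e0V] sym[OF that \<gamma>V] scale[OF \<gamma>V that, of "1 / s"] by (simp add: e0_def)
      have "a \<gamma> e0 = s" using e0[OF \<gamma>V] s(1) by (simp flip: s(2))
      then have "e0 \<notin> E" using orth E(2) s(1) by force
      have "\<beta> \<in> span (insert \<beta> B)" by (simp add: span_base)
      then have "e0 \<in> span (insert \<beta> B)"
        unfolding e0_def \<gamma>_def using p span_mono[of B "insert \<beta> B"] by (intro span_scale span_diff) auto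
      moreover have "v = (\<Sum>e\<in>insert e0 E. a v e *\<^sub>R e)" if v: "v \<in> span (insert \<beta> B)" for v
      proof -
        obtain z c where zc: "z \<in> span B" "v = z + c *\<^sub>R \<gamma>" using decomp[OF v] by blast
        have zV: "z \<in> V" using zc BV by blast
        have vu: "a v u = a z u + c * a \<gamma> u" if "u \<in> V" for u
          unfolding zc(2) using add[OF zV _ that] scale[OF \<gamma>V that] \<gamma>V V by (simp add: subspace_scale)
        have "a v e = a z e" if "e \<in> E" for e
          using vu[of e] orth[of e] subsetD[OF EV that] subsetD[OF E(2) that] by simp
        then have "(\<Sum>e\<in>E. a v e *\<^sub>R e) = z" using E(3)[OF zc(1)] by simp
        moreover have "a v e0 *\<^sub>R e0 = c *\<^sub>R \<gamma>"
        proof -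
          have "a z \<gamma> = 0" using orth[OF zc(1)] sym[OF zV \<gamma>V] by simp
          then have "a v e0 = c * s"
            using vu[OF e0V] e0[OF zV] \<open>a \<gamma> e0 = s\<close> by simp
          then show ?thesis using s(1) by (simp add: e0_def)
        qed
        ultimately show ?thesis using E(1) \<open>e0 \<notin> E\<close> zc(2) by simp
      qed
      ultimately show ?thesis
        using E(1,2) span_mono[of B "insert \<beta> B"] by (intro exI[of _ "insert e0 E"]) auto
    qed
  qed
  then show ?thesis using that by blast
qed

section \<open>The finite element space\<close>

text \<open>Simplices of full dimension have nonempty interior.\<close>

lemma fe_mesh_affine_mesh:
  fixes \<Omega> :: "(real^'n) set"
  assumes "open \<Omega>" and "bounded \<Omega>" and "fe_mesh \<Omega> \<T>"
  shows "affine_mesh \<Omega> \<T>"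
proof
  fix K assume "K \<in> \<T>"
  then have K: "int CARD('n) simplex K" using assms(3) by (simp add: fe_mesh_def)
  show "compact K" "convex K" using K by (auto intro: compact_simplex convex_simplex)
  have ad: "aff_dim K = int DIM(real^'n)" using aff_dim_simplex[OF K] by simp
  then have "rel_interior K = interior K"
    by (rule interior_rel_interior)
  moreover have "K \<noteq> {}" using ad by auto
  ultimately show "interior K \<noteq> {}" using \<open>convex K\<close> rel_interior_eq_empty by metis
qed (use assms in \<open>auto simp: fe_mesh_def triangulation_def\<close>)

lemma finite_mesh_nodes:
  fixes \<Omega> :: "(real^'n) set"
  assumes "fe_mesh \<Omega> \<T>"
  shows "finite (mesh_nodes \<T>)"
proof -
  have "finite {p. p extreme_point_of K}" if "K \<in> \<T>" for K
  proof -
    have "polyhedron K"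
      using assms that by (auto simp: fe_mesh_def intro: simplex_imp_polyhedron)
    then show ?thesis by (rule finite_polyhedron_extreme_points)
  qed
  moreover have "mesh_nodes \<T> = (\<Union>K\<in>\<T>. {p. p extreme_point_of K})"
    by (auto simp: mesh_nodes_def)
  ultimately show ?thesis
    using assms by (simp add: fe_mesh_def triangulation_def)
qed

lemma lagrange_function_affineE:
  assumes "lagrange_function \<T> p \<psi>" and "K \<in> \<T>"
  obtains a b where "\<And>x. x \<in> K \<Longrightarrow> \<psi> x = a \<bullet> x + b"
proof -
  have "\<exists>a b. \<forall>x\<in>K. \<psi> x = a \<bullet> x + b"
    using assms unfolding lagrange_function_def by simp
  then show ?thesis using that by auto
qed

text \<open>A nodal function is determined by its node because a simplex is the convex hull of its extreme
  points. This makes the set of Lagrange fields finite, so that their span has finite dimension.\<close>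

lemma lagrange_function_unique:
  fixes \<Omega> :: "(real^'n) set"
  assumes mesh: "fe_mesh \<Omega> \<T>" and 1: "lagrange_function \<T> p \<psi>" and 2: "lagrange_function \<T> p \<psi>'"
  shows "\<psi> = \<psi>'"
proof (rule ext)
  fix x
  show "\<psi> x = \<psi>' x"
  proof (cases "x \<in> \<Union>\<T>")
    case True
    then obtain K where K: "K \<in> \<T>" "x \<in> K" by blast
    then have "int CARD('n) simplex K" using mesh by (simp add: fe_mesh_def)
    then have hull: "K = convex hull {q. q extreme_point_of K}"
      by (intro Krein_Milman_Minkowski compact_simplex convex_simplex)
    obtain a b where ab: "\<And>x. x \<in> K \<Longrightarrow> \<psi> x = a \<bullet> x + b"
      using lagrange_function_affineE[OF 1 K(1)] by metis
    obtain a' b' where ab': "\<And>x. x \<in> K \<Longrightarrow> \<psi>' x = a' \<bullet> x + b'"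
      using lagrange_function_affineE[OF 2 K(1)] by metis
    have "{q. q extreme_point_of K} \<subseteq> {y. (a - a') \<bullet> y = b' - b}"
    proof
      fix q assume "q \<in> {q. q extreme_point_of K}"
      then have q: "q \<in> mesh_nodes \<T>" "q \<in> K"
        using K(1) by (auto simp: mesh_nodes_def extreme_point_of_def)
      then have "\<psi> q = \<psi>' q" using 1 2 by (simp add: lagrange_function_def)
      then show "q \<in> {y. (a - a') \<bullet> y = b' - b}"
        using ab[OF q(2)] ab'[OF q(2)] by (simp add: inner_diff_left)
    qed
    then have "K \<subseteq> {y. (a - a') \<bullet> y = b' - b}"
      using hull hull_minimal[of _ _ convex] convex_hyperplane by metis
    then have "(a - a') \<bullet> x = b' - b" using K(2) by blast
    then show ?thesis using ab[OF K(2)] ab'[OF K(2)] by (simp add: inner_diff_left)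
  qed (use 1 2 in \<open>simp add: lagrange_function_def\<close>)
qed

lemma finite_lagrange_fields:
  fixes \<Omega> :: "(real^'n) set"
  assumes "fe_mesh \<Omega> \<T>"
  shows "finite (lagrange_fields \<Omega> \<T>)"
proof -
  have "lagrange_fields \<Omega> \<T> \<subseteq>
      (\<lambda>(p, j) x. (THE \<psi>. lagrange_function \<T> p \<psi>) x *\<^sub>R axis j 1) ` (mesh_nodes \<T> \<times> UNIV)"
  proof
    fix \<phi> assume "\<phi> \<in> lagrange_fields \<Omega> \<T>"
    then obtain \<psi> p j where *: "\<phi> = (\<lambda>x. \<psi> x *\<^sub>R axis j 1)" "p \<in> mesh_nodes \<T>" "lagrange_function \<T> p \<psi>"
      unfolding lagrange_fields_def by blast
    have "(THE \<psi>. lagrange_function \<T> p \<psi>) = \<psi>"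
      using *(3) lagrange_function_unique[OF assms] by blast
    then show "\<phi> \<in> (\<lambda>(p, j) x. (THE \<psi>. lagrange_function \<T> p \<psi>) x *\<^sub>R axis j 1) ` (mesh_nodes \<T> \<times> UNIV)"
      using * by (intro image_eqI[of _ _ "(p, j)"]) auto
  qed
  then show ?thesis
    by (rule finite_subset) (intro finite_imageI finite_cartesian_product finite_mesh_nodes[OF assms] finite)
qed

lemma (in affine_mesh) lagrange_fields_pw_affine: "lagrange_fields \<Omega> \<T> \<subseteq> pw_affine"
proof
  fix \<phi> assume "\<phi> \<in> lagrange_fields \<Omega> \<T>"
  then obtain \<psi> p j where \<phi>: "\<phi> = (\<lambda>x. \<psi> x *\<^sub>R axis j 1)" and \<psi>: "lagrange_function \<T> p \<psi>"
    and c: "continuous_on (closure \<Omega>) \<psi>" and f: "\<And>x. x \<in> frontier \<Omega> \<Longrightarrow> \<psi> x = 0"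
    unfolding lagrange_fields_def by blast
  have out: "\<psi> x = 0" if "x \<notin> \<Union>\<T>" for x using \<psi> that unfolding lagrange_function_def by simp
  have zero: "\<psi> x = 0" if "x \<notin> \<Omega>" for x
  proof (cases "x \<in> closure \<Omega>")
    case True
    then show ?thesis using f that open_domain by (simp add: frontier_def interior_open)
  next
    case False
    then show ?thesis using out mesh_subset by blast
  qed
  have "continuous_on (- \<Omega>) \<psi>"
    using zero by (subst continuous_on_cong[where g = "\<lambda>x. 0"]) auto
  then have "continuous_on (closure \<Omega> \<union> - \<Omega>) \<psi>"
    using c open_domain by (intro continuous_on_closed_Un) (auto simp: closed_Compl)
  moreover have "closure \<Omega> \<union> - \<Omega> = UNIV" using closure_subset by blast
  ultimately have cont: "continuous_on UNIV \<psi>" by simp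
  show "\<phi> \<in> pw_affine"
  proof (rule pw_affineI)
    show "continuous_on UNIV \<phi>" unfolding \<phi> by (intro continuous_intros cont)
    show "\<phi> x = 0" if "x \<notin> \<Omega>" for x using zero[OF that] by (simp add: \<phi>)
    show "\<phi> x = 0" if "x \<notin> \<Union>\<T>" for x using out[OF that] by (simp add: \<phi>)
    fix K assume "K \<in> \<T>"
    obtain a b where ab: "\<And>x. x \<in> K \<Longrightarrow> \<psi> x = a \<bullet> x + b"
      using lagrange_function_affineE[OF \<psi> \<open>K \<in> \<T>\<close>] by metis
    have "(\<chi> k l. axis j 1 $ k * a $ l) *v x = (a \<bullet> x) *\<^sub>R axis j 1" for x
      by (simp add: vec_eq_iff matrix_vector_mult_def inner_vec_def sum_distrib_left mult_ac)
    then show "\<exists>A b. \<forall>x\<in>K. \<phi> x = A *v x + b"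
      by (intro exI[of _ "\<chi> k l. axis j 1 $ k * a $ l"] exI[of _ "b *\<^sub>R axis j 1"])
        (simp add: \<phi> ab scaleR_add_left)
  qed
qed

context affine_mesh
begin

lemma pw_affine_in_bcontfun: "w \<in> pw_affine \<Longrightarrow> w \<in> bcontfun"
  using pw_affine_continuous pw_affine_bounded by (auto simp: bcontfun_def bounded_iff) metis

text \<open>Piecewise affine fields as elements of the normed space of bounded continuous functions, where
  spans are available and the norm is the supremum norm.\<close>

definition pw_affine_bcontfun :: "((real^'n) \<Rightarrow>\<^sub>C (real^'n)) set" where
  "pw_affine_bcontfun = {v. apply_bcontfun v \<in> pw_affine}"

lemma subspace_pw_affine_bcontfun: "subspace pw_affine_bcontfun"
proof (rule subspaceI)
  have "apply_bcontfun (0 :: (real^'n) \<Rightarrow>\<^sub>C (real^'n)) = (\<lambda>x. 0)" by (simp add: fun_eq_iff)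
  then show "0 \<in> pw_affine_bcontfun" using zero_pw_affine by (simp add: pw_affine_bcontfun_def)
  fix v w assume *: "v \<in> pw_affine_bcontfun" "w \<in> pw_affine_bcontfun"
  have "apply_bcontfun (v + w) = (\<lambda>x. apply_bcontfun v x + apply_bcontfun w x)" by (simp add: fun_eq_iff)
  then show "v + w \<in> pw_affine_bcontfun" using add_pw_affine * by (simp add: pw_affine_bcontfun_def)
next
  fix c v assume *: "v \<in> pw_affine_bcontfun"
  have "apply_bcontfun (c *\<^sub>R v) = (\<lambda>x. c *\<^sub>R apply_bcontfun v x)" by (simp add: fun_eq_iff)
  then show "c *\<^sub>R v \<in> pw_affine_bcontfun" using scaleR_pw_affine * by (simp add: pw_affine_bcontfun_def)
qed

lemma pw_grad_sum:
  assumes "finite I" and "\<And>i. i \<in> I \<Longrightarrow> apply_bcontfun (v i) \<in> pw_affine"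
  shows "pw_grad (apply_bcontfun (\<Sum>i\<in>I. c i *\<^sub>R v i)) x = (\<Sum>i\<in>I. c i *\<^sub>R pw_grad (apply_bcontfun (v i)) x)"
  using assms
proof (induction I rule: finite_induct)
  case empty
  have "apply_bcontfun (0 :: (real^'n) \<Rightarrow>\<^sub>C (real^'n)) = (\<lambda>x. 0 *\<^sub>R 0)" by (simp add: fun_eq_iff)
  then show ?case using pw_grad_scaleR[OF zero_pw_affine, of 0 x] by simp
next
  case (insert i I)
  let ?s = "\<Sum>i\<in>I. c i *\<^sub>R v i"
  have s: "apply_bcontfun ?s \<in> pw_affine"
    using subspace_sum[OF subspace_pw_affine_bcontfun, of I "\<lambda>i. c i *\<^sub>R v i"] insert.prems
      subspace_scale[OF subspace_pw_affine_bcontfun]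
    by (simp add: pw_affine_bcontfun_def)
  have "apply_bcontfun (\<Sum>i\<in>insert i I. c i *\<^sub>R v i) = (\<lambda>x. c i *\<^sub>R apply_bcontfun (v i) x + apply_bcontfun ?s x)"
    using insert.hyps by (simp add: fun_eq_iff)
  then show ?case
    using insert s by (simp add: pw_grad_add scaleR_pw_affine pw_grad_scaleR)
qed

lemma apply_bcontfun_sum_scaleR:
  "apply_bcontfun (\<Sum>i\<in>I. c i *\<^sub>R v i) x = (\<Sum>i\<in>I. c i *\<^sub>R apply_bcontfun (v i) x)"
  by (induction I rule: infinite_finite_induct) auto

text \<open>Discrete stability. If the functional \<open>elastic_form E \<nu> \<Omega> w\<close> is bounded by \<open>Q\<close> in the supremum norm on
  the span, each Fourier coefficient of \<open>w\<close> with respect to a fixed energy-orthonormal family is bounded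
  by \<open>Q\<close> times a constant, and so are \<open>w\<close> and its gradient. The constant does not depend on \<open>w\<close> and \<open>Q\<close>.\<close>

lemma elastic_form_controls_H1_norm:
  fixes B :: "((real^'n) \<Rightarrow>\<^sub>C (real^'n)) set"
  assumes "E > 0" and "0 \<le> \<nu>" and "\<nu> < 1/2" and "finite B" and B: "B \<subseteq> pw_affine_bcontfun"
  obtains C where "C \<ge> 0" and "\<And>w Q. w \<in> span B \<Longrightarrow>
      (\<And>\<phi>. \<phi> \<in> span B \<Longrightarrow> \<bar>elastic_form E \<nu> \<Omega> (apply_bcontfun w) (apply_bcontfun \<phi>)\<bar> \<le> Q * norm \<phi>) \<Longrightarrow>
      H1_norm \<Omega> (apply_bcontfun w) \<le> C * Q"
proof -
  define a where "a v w = elastic_form E \<nu> \<Omega> (apply_bcontfun v) (apply_bcontfun w)"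
    for v w :: "(real^'n) \<Rightarrow>\<^sub>C (real^'n)"
  have pw: "apply_bcontfun v \<in> pw_affine" if "v \<in> pw_affine_bcontfun" for v
    using that by (simp add: pw_affine_bcontfun_def)
  have plus: "apply_bcontfun (u + v) = (\<lambda>x. apply_bcontfun u x + apply_bcontfun v x)"
    for u v :: "(real^'n) \<Rightarrow>\<^sub>C (real^'n)" by (simp add: fun_eq_iff)
  have scale: "apply_bcontfun (r *\<^sub>R u) = (\<lambda>x. r *\<^sub>R apply_bcontfun u x)"
    for r and u :: "(real^'n) \<Rightarrow>\<^sub>C (real^'n)" by (simp add: fun_eq_iff)
  obtain \<E> where \<E>: "finite \<E>" "\<E> \<subseteq> span B" "\<And>v. v \<in> span B \<Longrightarrow> v = (\<Sum>e\<in>\<E>. a v e *\<^sub>R e)"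
  proof (rule inner_product_expansion[OF \<open>finite B\<close> subspace_pw_affine_bcontfun B, of a])
    show "a (u + v) w = a u w + a v w"
      if "u \<in> pw_affine_bcontfun" "v \<in> pw_affine_bcontfun" "w \<in> pw_affine_bcontfun" for u v w
      unfolding a_def plus by (intro elastic_form_add pw that)
    show "a (r *\<^sub>R u) v = r * a u v" if "u \<in> pw_affine_bcontfun" "v \<in> pw_affine_bcontfun" for r u v
      unfolding a_def scale by (intro elastic_form_scaleR pw that)
    show "a u v = a v u" if "u \<in> pw_affine_bcontfun" "v \<in> pw_affine_bcontfun" for u v
      unfolding a_def by (intro elastic_form_commute pw that)
    show "a u u > 0" if "u \<in> pw_affine_bcontfun" "u \<noteq> 0" for u
      unfolding a_def
    proof (rule elastic_form_pos[OF assms(1-3) pw[OF that(1)]])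
      show "apply_bcontfun u \<noteq> (\<lambda>x. 0)"
        using that(2) by (metis bcontfun_eqI zero_bcontfun.rep_eq)
    qed
  qed (use that in blast)
  have OV: "\<E> \<subseteq> pw_affine_bcontfun"
    using \<E>(2) span_minimal[OF B subspace_pw_affine_bcontfun] by blast
  have "\<forall>e\<in>\<E>. \<exists>M. \<forall>x. norm (pw_grad (apply_bcontfun e) x) \<le> M"
    using OV pw pw_grad_bounded by (metis subsetD)
  then obtain M where M: "\<And>e x. e \<in> \<E> \<Longrightarrow> norm (pw_grad (apply_bcontfun e) x) \<le> M e"
    by metis
  have M0: "M e \<ge> 0" if "e \<in> \<E>" for e using M[OF that, of 0] norm_ge_zero order_trans by blast
  define C where "C = sqrt (measure lebesgue \<Omega>) * (\<Sum>e\<in>\<E>. norm e * (norm e + M e))"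
  show ?thesis
  proof (rule that[of C])
    show "C \<ge> 0" unfolding C_def using M0 by (intro mult_nonneg_nonneg sum_nonneg) auto
    fix w Q assume w: "w \<in> span B"
      and Q: "\<And>\<phi>. \<phi> \<in> span B \<Longrightarrow> \<bar>elastic_form E \<nu> \<Omega> (apply_bcontfun w) (apply_bcontfun \<phi>)\<bar> \<le> Q * norm \<phi>"
    have aQ: "\<bar>a w e\<bar> \<le> Q * norm e" if "e \<in> \<E>" for e
      using Q[of e] \<E>(2) that unfolding a_def by blast
    have wV: "apply_bcontfun w \<in> pw_affine"
      using w span_minimal[OF B subspace_pw_affine_bcontfun] pw by blast
    have eq: "w = (\<Sum>e\<in>\<E>. a w e *\<^sub>R e)" by (rule \<E>(3)[OF w])
    have "norm (apply_bcontfun w x) \<le> (\<Sum>e\<in>\<E>. (Q * norm e) * norm e)" for x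
    proof -
      have "apply_bcontfun w x = (\<Sum>e\<in>\<E>. a w e *\<^sub>R apply_bcontfun e x)"
        by (subst eq) (rule apply_bcontfun_sum_scaleR)
      also have "norm \<dots> \<le> (\<Sum>e\<in>\<E>. \<bar>a w e\<bar> * norm (apply_bcontfun e x))"
        by (rule order_trans[OF norm_sum]) simp
      also have "\<dots> \<le> (\<Sum>e\<in>\<E>. (Q * norm e) * norm e)"
        by (intro sum_mono mult_mono aQ norm_bounded) (auto intro: order_trans[OF abs_ge_zero aQ])
      finally show ?thesis .
    qed
    moreover have "norm (pw_grad (apply_bcontfun w) x) \<le> (\<Sum>e\<in>\<E>. (Q * norm e) * M e)" for x
    proof -
      have "pw_grad (apply_bcontfun w) x = (\<Sum>e\<in>\<E>. a w e *\<^sub>R pw_grad (apply_bcontfun e) x)"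
        by (subst eq) (use OV pw in \<open>intro pw_grad_sum \<E>(1), auto\<close>)
      also have "norm \<dots> \<le> (\<Sum>e\<in>\<E>. \<bar>a w e\<bar> * norm (pw_grad (apply_bcontfun e) x))"
        by (rule order_trans[OF norm_sum]) simp
      also have "\<dots> \<le> (\<Sum>e\<in>\<E>. (Q * norm e) * M e)"
        by (intro sum_mono mult_mono aQ M) (auto intro: order_trans[OF abs_ge_zero aQ])
      finally show ?thesis .
    qed
    ultimately have "H1_norm \<Omega> (apply_bcontfun w) \<le>
        sqrt (measure lebesgue \<Omega>) * ((\<Sum>e\<in>\<E>. (Q * norm e) * norm e) + (\<Sum>e\<in>\<E>. (Q * norm e) * M e))"
      by (rule H1_norm_le[OF wV])
    also have "\<dots> = C * Q"
      by (simp add: C_def sum.distrib [symmetric] sum_distrib_left sum_distrib_right algebra_simps)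
    finally show "H1_norm \<Omega> (apply_bcontfun w) \<le> C * Q" .
  qed
qed

lemma fe_space_eq_span:
  assumes "finite (lagrange_fields \<Omega> \<T>)"
  shows "apply_bcontfun ` span (Bcontfun ` lagrange_fields \<Omega> \<T>) = fe_space \<Omega> \<T>"
proof -
  let ?L = "lagrange_fields \<Omega> \<T>"
  have inv: "apply_bcontfun (Bcontfun \<phi>) = \<phi>" if "\<phi> \<in> ?L" for \<phi>
    using that lagrange_fields_pw_affine pw_affine_in_bcontfun by (intro Bcontfun_inverse) blast
  have inj: "inj_on Bcontfun ?L" by (rule inj_on_inverseI[of _ apply_bcontfun]) (rule inv)
  show ?thesis
  proof (intro equalityI subsetI)
    fix u assume "u \<in> apply_bcontfun ` span (Bcontfun ` ?L)"
    then obtain c where c: "u = apply_bcontfun (\<Sum>v\<in>Bcontfun ` ?L. c v *\<^sub>R v)"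
      unfolding span_finite[OF finite_imageI[OF assms]] by auto
    have "u = (\<lambda>x. \<Sum>\<phi>\<in>?L. c (Bcontfun \<phi>) *\<^sub>R \<phi> x)"
      unfolding c sum.reindex[OF inj] by (simp add: fun_eq_iff apply_bcontfun_sum_scaleR inv)
    then show "u \<in> fe_space \<Omega> \<T>"
      unfolding fe_space_def using assms by (intro CollectI exI[of _ ?L] exI[of _ "\<lambda>\<phi>. c (Bcontfun \<phi>)"]) auto
  next
    fix u assume "u \<in> fe_space \<Omega> \<T>"
    then obtain B c where *: "u = (\<lambda>x. \<Sum>\<phi>\<in>B. c \<phi> *\<^sub>R \<phi> x)" "finite B" "B \<subseteq> ?L"
      unfolding fe_space_def by blast
    have "u = apply_bcontfun (\<Sum>\<phi>\<in>B. c \<phi> *\<^sub>R Bcontfun \<phi>)"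
      using *(3) inv by (auto simp: *(1) fun_eq_iff apply_bcontfun_sum_scaleR intro!: sum.cong)
    moreover have "(\<Sum>\<phi>\<in>B. c \<phi> *\<^sub>R Bcontfun \<phi>) \<in> span (Bcontfun ` ?L)"
      using *(3) by (intro span_sum span_scale span_base) auto
    ultimately show "u \<in> apply_bcontfun ` span (Bcontfun ` ?L)" by blast
  qed
qed

end

section \<open>The error estimate\<close>

lemma force_integrable:
  fixes f :: "real^'n \<Rightarrow> real^'n" and \<phi> :: "(real^'n) \<Rightarrow>\<^sub>C (real^'n)"
  assumes "continuous_on UNIV f" and "open \<Omega>" and "bounded \<Omega>"
  shows "integrable (lebesgue_on \<Omega>) (\<lambda>x. f x \<bullet> apply_bcontfun \<phi> x)"
proof -
  have m: "\<Omega> \<in> lmeasurable" using assms(2,3) by (simp add: lmeasurable_open)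
  interpret finite_measure "lebesgue_on \<Omega>" using m by (rule finite_measure_lebesgue_on)
  have c: "continuous_on UNIV (\<lambda>x. f x \<bullet> apply_bcontfun \<phi> x)" by (intro continuous_intros assms(1)) auto
  have "bounded ((\<lambda>x. f x \<bullet> apply_bcontfun \<phi> x) ` closure \<Omega>)"
    using assms(3) by (intro compact_imp_bounded compact_continuous_image continuous_on_subset[OF c]) auto
  then obtain B where B: "\<And>x. x \<in> closure \<Omega> \<Longrightarrow> \<bar>f x \<bullet> apply_bcontfun \<phi> x\<bar> \<le> B"
    unfolding bounded_iff by auto
  show ?thesis
  proof (rule integrable_const_bound[where B = B])
    show "AE x in lebesgue_on \<Omega>. norm (f x \<bullet> apply_bcontfun \<phi> x) \<le> B"
      using B closure_subset by (intro AE_I2) auto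
    show "(\<lambda>x. f x \<bullet> apply_bcontfun \<phi> x) \<in> borel_measurable (lebesgue_on \<Omega>)"
      by (intro measurable_restrict_space1 measurable_completion) (simp add: borel_measurable_continuous_onI[OF c])
  qed
qed

lemma continuous_smoothed_force: "continuous_on UNIV (smoothed_force P x' \<Delta> \<epsilon>)"
  unfolding smoothed_force_def by (intro continuous_intros)

lemma continuous_particle_force:
  assumes "\<epsilon> > 0" shows "continuous_on UNIV (particle_force P x' \<Delta> \<epsilon> :: real^'n \<Rightarrow> real^'n)"
  unfolding particle_force_def grad_def partial_gauss_delta[OF assms]
  using assms by (intro continuous_intros) auto

theorem theorem3p2:
  fixes \<Omega> :: "(real^'n) set" and \<T> :: "(real^'n) set set" and x' :: "real^'n"
    and E \<nu> P :: real
  assumes "CARD('n) > 1"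
    and "open \<Omega>" and "bounded \<Omega>" and "connected \<Omega>"
    and "x' \<in> \<Omega>"
    and "E > 0" and "0 \<le> \<nu>" and "\<nu> < 1/2"
    and "fe_mesh \<Omega> \<T>"
  shows "\<exists>L2>0. \<forall>\<Delta>>0. \<forall>\<epsilon>>0. \<forall>u\<^sub>\<epsilon> u\<^sub>S.
           cell x' \<Delta> \<subseteq> \<Omega> \<longrightarrow>
           galerkin_solution E \<nu> \<Omega> (fe_space \<Omega> \<T>) (smoothed_force P x' \<Delta> \<epsilon>) u\<^sub>\<epsilon> \<longrightarrow>
           galerkin_solution E \<nu> \<Omega> (fe_space \<Omega> \<T>) (particle_force P x' \<Delta> \<epsilon>) u\<^sub>S \<longrightarrow>
           1 / \<Delta> ^ CARD('n) * H1_norm \<Omega> (\<lambda>x. u\<^sub>S x - u\<^sub>\<epsilon> x) \<le> L2 * (\<Delta>\<^sup>2 / \<epsilon> ^ 3)"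
proof -
  interpret affine_mesh \<Omega> \<T> using assms by (intro fe_mesh_affine_mesh)
  define B where "B = Bcontfun ` lagrange_fields \<Omega> \<T>"
  have fin: "finite (lagrange_fields \<Omega> \<T>)" by (rule finite_lagrange_fields[OF assms(9)])
  have V: "fe_space \<Omega> \<T> = apply_bcontfun ` span B"
    unfolding B_def by (rule fe_space_eq_span[OF fin, symmetric])
  have BV: "B \<subseteq> pw_affine_bcontfun"
    unfolding B_def pw_affine_bcontfun_def
    using lagrange_fields_pw_affine pw_affine_in_bcontfun by (auto simp: Bcontfun_inverse subset_iff)
  then have span_pw: "apply_bcontfun v \<in> pw_affine" if "v \<in> span B" for v
    using that span_minimal[OF BV subspace_pw_affine_bcontfun] by (auto simp: pw_affine_bcontfun_def)
  obtain C where C: "C \<ge> 0" "\<And>w Q. w \<in> span B \<Longrightarrow>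
      (\<And>\<phi>. \<phi> \<in> span B \<Longrightarrow> \<bar>elastic_form E \<nu> \<Omega> (apply_bcontfun w) (apply_bcontfun \<phi>)\<bar> \<le> Q * norm \<phi>) \<Longrightarrow>
      H1_norm \<Omega> (apply_bcontfun w) \<le> C * Q"
    using elastic_form_controls_H1_norm[OF assms(6-8) _ BV] fin unfolding B_def by blast
  define L where "L = C * (\<bar>P\<bar> * (3 * CARD('n) * 2 ^ CARD('n)))"
  have "L \<ge> 0" unfolding L_def using C(1) by (intro mult_nonneg_nonneg) auto
  have "1 / \<Delta> ^ CARD('n) * H1_norm \<Omega> (\<lambda>x. uS x - ue x) \<le> (L + 1) * (\<Delta>\<^sup>2 / \<epsilon> ^ 3)"
    if \<Delta>: "\<Delta> > 0" and \<epsilon>: "\<epsilon> > 0"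
      and ue: "galerkin_solution E \<nu> \<Omega> (fe_space \<Omega> \<T>) (smoothed_force P x' \<Delta> \<epsilon>) ue"
      and uS: "galerkin_solution E \<nu> \<Omega> (fe_space \<Omega> \<T>) (particle_force P x' \<Delta> \<epsilon>) uS"
    for \<Delta> \<epsilon> ue uS
  proof -
    obtain s where s: "s \<in> span B" "uS = apply_bcontfun s"
      using uS unfolding galerkin_solution_def V by blast
    obtain e where e: "e \<in> span B" "ue = apply_bcontfun e"
      using ue unfolding galerkin_solution_def V by blast
    define Q where "Q = (\<bar>P\<bar> * \<Delta> ^ CARD('n)) * (3 * CARD('n) * 2 ^ CARD('n) * (\<Delta>\<^sup>2 / \<epsilon> ^ 3))"
    have bound: "\<bar>elastic_form E \<nu> \<Omega> (apply_bcontfun (s - e)) (apply_bcontfun \<phi>)\<bar> \<le> Q * norm \<phi>"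
      if \<phi>: "\<phi> \<in> span B" for \<phi>
    proof -
      note pw = span_pw[OF s(1)] span_pw[OF e(1)] span_pw[OF \<phi>]
      have mem: "apply_bcontfun \<phi> \<in> fe_space \<Omega> \<T>" unfolding V using \<phi> by blast
      have "apply_bcontfun (s - e) = (\<lambda>x. apply_bcontfun s x + (- 1) *\<^sub>R apply_bcontfun e x)"
        by (simp add: fun_eq_iff)
      then have "elastic_form E \<nu> \<Omega> (apply_bcontfun (s - e)) (apply_bcontfun \<phi>) =
          elastic_form E \<nu> \<Omega> (apply_bcontfun s) (apply_bcontfun \<phi>) -
          elastic_form E \<nu> \<Omega> (apply_bcontfun e) (apply_bcontfun \<phi>)"
        using elastic_form_add[OF pw(1) scaleR_pw_affine[OF pw(2), of "- 1"] pw(3)]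
          elastic_form_scaleR[OF pw(2,3), of E \<nu> "- 1"] by simp
      also have "\<dots> = (LINT x|lebesgue_on \<Omega>. particle_force P x' \<Delta> \<epsilon> x \<bullet> apply_bcontfun \<phi> x) -
          (LINT x|lebesgue_on \<Omega>. smoothed_force P x' \<Delta> \<epsilon> x \<bullet> apply_bcontfun \<phi> x)"
        using uS ue mem unfolding galerkin_solution_def s(2) e(2) by simp
      also have "\<dots> = (LINT x|lebesgue_on \<Omega>.
          (particle_force P x' \<Delta> \<epsilon> x - smoothed_force P x' \<Delta> \<epsilon> x) \<bullet> apply_bcontfun \<phi> x)"
        unfolding inner_diff_left
        by (intro Bochner_Integration.integral_diff[symmetric] force_integrable assms
            continuous_particle_force continuous_smoothed_force \<epsilon>)
      also have "\<bar>\<dots>\<bar> \<le> Q * norm \<phi>"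
        unfolding Q_def using domain_lmeasurable
        by (intro smoothed_force_error \<Delta> \<epsilon> norm_bounded) auto
      finally show ?thesis .
    qed
    have "(\<lambda>x. uS x - ue x) = apply_bcontfun (s - e)" by (simp add: s(2) e(2) fun_eq_iff)
    then have "H1_norm \<Omega> (\<lambda>x. uS x - ue x) \<le> C * Q"
      using C(2)[OF span_diff[OF s(1) e(1)] bound] by simp
    then have "1 / \<Delta> ^ CARD('n) * H1_norm \<Omega> (\<lambda>x. uS x - ue x) \<le> 1 / \<Delta> ^ CARD('n) * (C * Q)"
      using \<Delta> by (intro mult_left_mono) auto
    also have "\<dots> = L * (\<Delta>\<^sup>2 / \<epsilon> ^ 3)" using \<Delta> by (simp add: L_def Q_def)
    also have "\<dots> \<le> (L + 1) * (\<Delta>\<^sup>2 / \<epsilon> ^ 3)" using \<Delta> \<epsilon> by (intro mult_right_mono) auto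
    finally show ?thesis .
  qed
  \<comment> \<open>\<open>L\<close> itself vanishes when \<open>P = 0\<close>.\<close>
  then show ?thesis using \<open>L \<ge> 0\<close> by (intro exI[of _ "L + 1"]) auto
qed

end
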